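(* The compact abelian embedding algorithm described in the context terminates on every finite connected graph $G$ with $n$ vertices and returns a certified isometric embedding $\phi\colon V(G)\to\mathrm{Cay}(\Gamma,S)$, with $\Gamma=\prod_i\mathbb{Z}_{N_i}$ a finite abelian group satisfying $|\Gamma|\le 2^{\,n-1}$.
   Context: $\mathrm{Cay}(\Gamma,S)$, for a generating set $S=-S\subseteq\Gamma\setminus\{0\}$ of an abelian group, is the graph on $\Gamma$ with edges $\{h,h+s\}$, $s\in S$. An isometric embedding of $G$ is an injection $\phi\colon V(G)\to\Gamma$ such that Cayley distance between images equals the shortest-path distance $d_G$. "Certified" means that the returned embedding has passed the exact check: all $\binom n2$ distances $d_G(u,v)$ are compared with the Cayley distances computed by breadth-first search (truncated at depth $\mathrm{diam}(G)$) in the candidate Cayley graph. An oriented partition is a partition $\{F_1,\dots,F_t\}$ of $E(G)$ with a chosen forward direction for each edge. Its signed cycle–class matrix $A$, with respect to an integral cycle basis $B_1,\dots,B_c$, has entries $A[i,j]$ equal to the net signed number of crossings of $F_j$ by $B_i$. Its universal group is $\Gamma_{\mathrm{univ}}=\mathbb{Z}^t/\mathrm{rowlattice}(A)\cong T\times\mathbb{Z}^f$ ($T$ finite, computed by Smith normal form), with class generators $g_j$ the images of the standard basis vectors and vertex labels given by signed sums of class generators along paths from a root. A fold is the quotient by a finite-index sublattice $L\subseteq\mathbb{Z}^f$, with induced labels and connection set the nonzero images of the $\pm g_j$. Algorithm (input: a finite connected graph $G$). (1) Compute all pairwise distances and the diameter. (2) Build a finite list (portfolio) of initial oriented partitions of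 $G$. (3) For each initial partition, repeat: compute the universal group, generators and labels; search folds in increasing host order up to a fixed cap on the host order, enumerating sublattices by Hermite-normal-form bases and applying the exact check to each candidate; if a candidate passes, record $(\Gamma,S,\phi)$ and leave the loop; otherwise repair the partition by peeling one edge off a largest class into a singleton class, and leave the loop if all classes are singletons. (4) Binary terminal: form the finest-partition binary quotient, i.e. take each edge as its own class, with generator $g_e$ the image of the basis vector of $e$ in $\mathbb{F}_2^{E}/\mathcal{Z}(G)$ ($\mathcal{Z}(G)$ the cycle space over $\mathbb{F}_2$), and label $v$ by the sum of the $g_e$ along a path from the root to $v$; record this host after applying the exact check to it. (5) Return the smallest recorded verified host. *)

theory Defs
  imports
    "Graph_Theory.Graph_Theory"
    "HOL-Algebra.Elementary_Groups"
    "HOL-Algebra.Product_Groups"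
    "Jordan_Normal_Form.Matrix"
begin

text \<open>
  A finite simple graph is a symmetric loop-free pair digraph (locale \<open>pair_graph\<close>): an
  undirected edge \<open>{u, v}\<close> is represented by its two darts \<open>(u, v)\<close> and \<open>(v, u)\<close>, and a walk is
  the list of darts it traverses.
\<close>

definition gdist :: "'a pair_pre_digraph \<Rightarrow> 'a \<Rightarrow> 'a \<Rightarrow> ereal" where
  "gdist G u v = wf_digraph.\<mu> (with_proj G) (\<lambda>_. 1) u v"

definition diam :: "'a pair_pre_digraph \<Rightarrow> ereal" where
  "diam G = (SUP u\<in>pverts G. SUP v\<in>pverts G. gdist G u v)"

definition uedges :: "'a pair_pre_digraph \<Rightarrow> 'a set set" where
  "uedges G = (\<lambda>(u, v). {u, v}) ` parcs G"

definition connection_set :: "('g, 'm) monoid_scheme \<Rightarrow> 'g set \<Rightarrow> bool" where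
  "connection_set \<Gamma> S \<longleftrightarrow>
     S \<subseteq> carrier \<Gamma> - {\<one>\<^bsub>\<Gamma>\<^esub>} \<and> m_inv \<Gamma> ` S = S \<and> generate \<Gamma> S = carrier \<Gamma>"

definition cayley :: "('g, 'm) monoid_scheme \<Rightarrow> 'g set \<Rightarrow> 'g pair_pre_digraph" where
  "cayley \<Gamma> S = \<lparr>pverts = carrier \<Gamma>, parcs = {(h, h \<otimes>\<^bsub>\<Gamma>\<^esub> s) | h s. h \<in> carrier \<Gamma> \<and> s \<in> S}\<rparr>"

definition isometric_embedding ::
    "'v pair_pre_digraph \<Rightarrow> ('g, 'm) monoid_scheme \<Rightarrow> 'g set \<Rightarrow> ('v \<Rightarrow> 'g) \<Rightarrow> bool" where
  "isometric_embedding G \<Gamma> S \<phi> \<longleftrightarrow>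
     \<phi> ` pverts G \<subseteq> carrier \<Gamma> \<and> inj_on \<phi> (pverts G) \<and>
     (\<forall>u\<in>pverts G. \<forall>v\<in>pverts G. gdist (cayley \<Gamma> S) (\<phi> u) (\<phi> v) = gdist G u v)"

text \<open>The state of the breadth-first search is the pair (current frontier, visited vertices).\<close>

primrec bfs :: "'a pair_pre_digraph \<Rightarrow> 'a \<Rightarrow> nat \<Rightarrow> 'a set \<times> 'a set" where
  "bfs C x 0 = ({x}, {x})"
| "bfs C x (Suc k) =
     (let (F, W) = bfs C x k; F' = parcs C `` F - W in (F', W \<union> F'))"

text \<open>Vertices not found up to the truncation depth \<open>D\<close> get distance \<open>\<infinity>\<close>.\<close>

definition bfs_dist :: "'a pair_pre_digraph \<Rightarrow> ereal \<Rightarrow> 'a \<Rightarrow> 'a \<Rightarrow> ereal" where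
  "bfs_dist C D x y =
     (if \<exists>k::nat. ereal (real k) \<le> D \<and> y \<in> fst (bfs C x k)
      then ereal (real (LEAST k. y \<in> fst (bfs C x k))) else \<infinity>)"

definition cyclic_product :: "nat list \<Rightarrow> (nat \<Rightarrow> int) monoid" where
  "cyclic_product Ns = product_group {..<length Ns} (\<lambda>i. integer_mod_group (Ns ! i))"

record 'v host =
  moduli :: "nat list"
  conn :: "(nat \<Rightarrow> int) set"
  emb :: "'v \<Rightarrow> nat \<Rightarrow> int"

abbreviation host_group :: "'v host \<Rightarrow> (nat \<Rightarrow> int) monoid" where
  "host_group h \<equiv> cyclic_product (moduli h)"

definition exact_check :: "'v pair_pre_digraph \<Rightarrow> 'v host \<Rightarrow> bool" where
  "exact_check G h \<longleftrightarrow>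
     (\<forall>u\<in>pverts G. \<forall>v\<in>pverts G. u \<noteq> v \<longrightarrow>
        bfs_dist (cayley (host_group h) (conn h)) (diam G) (emb h u) (emb h v) = gdist G u v)"

text \<open>
  \<open>presents Q X l h\<close>: \<open>h\<close> is the finite quotient group \<open>Q\<close> written in coordinates as a product of
  finite cyclic groups, with vertex labels \<open>l\<close> and with the nonzero elements of \<open>X \<union> -X\<close> as
  connection set. (A modulus \<open>0\<close> would be an infinite cyclic factor.)
\<close>

definition presents ::
    "('g, 'm) monoid_scheme \<Rightarrow> 'g set \<Rightarrow> ('v \<Rightarrow> 'g) \<Rightarrow> 'v host \<Rightarrow> bool" where
  "presents Q X l h \<longleftrightarrow>
     0 \<notin> set (moduli h) \<and>
     (\<exists>\<psi> \<in> iso Q (host_group h).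
        conn h = \<psi> ` (X \<union> m_inv Q ` X - {\<one>\<^bsub>Q\<^esub>}) \<and> emb h = \<psi> \<circ> l)"

text \<open>
  An oriented partition is the list of its classes, where each class is given by the forward darts
  of its edges; thus exactly one dart of every edge occurs, in exactly one class.
\<close>

type_synonym 'v opart = "('v \<times> 'v) set list"

definition oriented_partition :: "'v pair_pre_digraph \<Rightarrow> 'v opart \<Rightarrow> bool" where
  "oriented_partition G P \<longleftrightarrow>
     distinct P \<and> partition_on (\<Union>(set P)) (set P) \<and> \<Union>(set P) \<subseteq> parcs G \<and>
     (\<forall>a\<in>parcs G. a \<in> \<Union>(set P) \<longleftrightarrow> prod.swap a \<notin> \<Union>(set P))"

definition all_singletons :: "'v opart \<Rightarrow> bool" where
  "all_singletons P \<longleftrightarrow> (\<forall>F\<in>set P. card F = 1)"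

definition peel :: "'v opart \<Rightarrow> 'v opart \<Rightarrow> bool" where
  "peel P P' \<longleftrightarrow>
     (\<exists>j<length P. \<exists>e\<in>P ! j.
        (\<forall>F\<in>set P. card F \<le> card (P ! j)) \<and> P' = P[j := P ! j - {e}] @ [{e}])"

definition signed_crossings :: "('v \<times> 'v) set \<Rightarrow> ('v \<times> 'v) list \<Rightarrow> int" where
  "signed_crossings F p =
     (\<Sum>a\<leftarrow>p. if a \<in> F then 1 else if prod.swap a \<in> F then -1 else 0)"

definition Zpow :: "nat \<Rightarrow> (nat \<Rightarrow> int) monoid" where
  "Zpow t = product_group {..<t} (\<lambda>_. integer_group)"

definition row_lattice :: "int mat \<Rightarrow> (nat \<Rightarrow> int) set" where
  "row_lattice A =
     (\<lambda>y. \<lambda>j\<in>{..<dim_col A}. \<Sum>i<dim_row A. y i * A $$ (i, j)) ` carrier (Zpow (dim_row A))"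

text \<open>Integral cycles (elements of the kernel of the boundary map), as antisymmetric functions on darts.\<close>

definition circulation :: "'v pair_pre_digraph \<Rightarrow> ('v \<times> 'v \<Rightarrow> int) \<Rightarrow> bool" where
  "circulation G x \<longleftrightarrow>
     (\<forall>a. a \<notin> parcs G \<longrightarrow> x a = 0) \<and> (\<forall>a. x (prod.swap a) = - x a) \<and>
     (\<forall>v\<in>pverts G. (\<Sum>a | a \<in> parcs G \<and> fst a = v. x a) = 0)"

text \<open>
  The two-dart closed walks \<open>[(u, v), (v, u)]\<close>, which count as \<open>cycle\<close> in a symmetric digraph,
  have zero net traversals and so are excluded by uniqueness of the coefficients.
\<close>

definition integral_cycle_basis :: "'v pair_pre_digraph \<Rightarrow> ('v \<times> 'v) list list \<Rightarrow> bool" where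
  "integral_cycle_basis G Bs \<longleftrightarrow>
     (\<forall>B\<in>set Bs. pre_digraph.cycle (with_proj G) B) \<and>
     (\<forall>x. circulation G x \<longrightarrow>
        (\<exists>!y. y \<in> carrier (Zpow (length Bs)) \<and>
          (\<forall>a. x a = (\<Sum>i<length Bs. y i * signed_crossings {a} (Bs ! i)))))"

definition cycle_class_matrix :: "('v \<times> 'v) list list \<Rightarrow> 'v opart \<Rightarrow> int mat" where
  "cycle_class_matrix Bs P =
     mat (length Bs) (length P) (\<lambda>(i, j). signed_crossings (P ! j) (Bs ! i))"

definition univ_group :: "int mat \<Rightarrow> (nat \<Rightarrow> int) set monoid" where
  "univ_group A = Zpow (dim_col A) Mod row_lattice A"

definition class_gen :: "int mat \<Rightarrow> nat \<Rightarrow> (nat \<Rightarrow> int) set" where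
  "class_gen A j =
     row_lattice A #>\<^bsub>Zpow (dim_col A)\<^esub> (\<lambda>i\<in>{..<dim_col A}. if i = j then 1 else 0)"

definition dart_gen :: "int mat \<Rightarrow> 'v opart \<Rightarrow> 'v \<times> 'v \<Rightarrow> (nat \<Rightarrow> int) set" where
  "dart_gen A P a =
     (let j = (THE j. j < length P \<and> (a \<in> P ! j \<or> prod.swap a \<in> P ! j))
      in if a \<in> P ! j then class_gen A j else inv\<^bsub>univ_group A\<^esub> (class_gen A j))"

definition path_sum :: "('g, 'm) monoid_scheme \<Rightarrow> ('d \<Rightarrow> 'g) \<Rightarrow> 'd list \<Rightarrow> 'g" where
  "path_sum \<Gamma> \<gamma> p = foldr (\<lambda>a x. \<gamma> a \<otimes>\<^bsub>\<Gamma>\<^esub> x) p \<one>\<^bsub>\<Gamma>\<^esub>"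

definition path_labels ::
    "'v pair_pre_digraph \<Rightarrow> ('g, 'm) monoid_scheme \<Rightarrow> ('v \<times> 'v \<Rightarrow> 'g) \<Rightarrow> ('v \<Rightarrow> 'g) \<Rightarrow> bool" where
  "path_labels G \<Gamma> \<gamma> l \<longleftrightarrow>
     (\<exists>r\<in>pverts G. \<forall>v\<in>pverts G. \<exists>p.
        pre_digraph.apath (with_proj G) r p v \<and> l v = path_sum \<Gamma> \<gamma> p)"

text \<open>
  Universal group in Smith coordinates, i.e. as \<open>T \<times> \<int>\<^sup>f\<close> with \<open>T\<close> a product of finite cyclic groups
  whose orders form a divisibility chain, together with class generators and vertex labels.
\<close>

type_synonym elem = "(nat \<Rightarrow> int) \<times> (nat \<Rightarrow> int)"

record 'v univ_data =
  torsion :: "nat list"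
  free_rank :: nat
  gens :: "elem list"
  labels :: "'v \<Rightarrow> elem"

definition split_group :: "'v univ_data \<Rightarrow> elem monoid" where
  "split_group U = cyclic_product (torsion U) \<times>\<times> Zpow (free_rank U)"

definition universal :: "'v pair_pre_digraph \<Rightarrow> 'v opart \<Rightarrow> 'v univ_data \<Rightarrow> bool" where
  "universal G P U \<longleftrightarrow>
     0 \<notin> set (torsion U) \<and> sorted_wrt (dvd) (torsion U) \<and>
     (\<exists>Bs. integral_cycle_basis G Bs \<and>
       (let A = cycle_class_matrix Bs P in
         \<exists>\<theta> \<in> iso (univ_group A) (split_group U). \<exists>l.
           gens U = map (\<theta> \<circ> class_gen A) [0..<length P] \<and>
           path_labels G (univ_group A) (dart_gen A P) l \<and>
           labels U = \<theta> \<circ> l))"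

text \<open>
  Bases (as rows) of the finite-index sublattices of \<open>\<int>\<^sup>f\<close> in Hermite normal form: upper triangular
  with positive diagonal, the entries above a pivot being reduced modulo that pivot.
\<close>

definition hnf_basis :: "nat \<Rightarrow> int mat \<Rightarrow> bool" where
  "hnf_basis f H \<longleftrightarrow>
     H \<in> carrier_mat f f \<and> upper_triangular H \<and> (\<forall>j<f. 0 < H $$ (j, j)) \<and>
     (\<forall>j<f. \<forall>i<j. 0 \<le> H $$ (i, j) \<and> H $$ (i, j) < H $$ (j, j))"

text \<open>\<open>|T|\<close> times the index of the sublattice, which is the product of the pivots.\<close>

definition fold_order :: "'v univ_data \<Rightarrow> int mat \<Rightarrow> nat" where
  "fold_order U H = prod_list (torsion U) * nat (\<Prod>i<free_rank U. H $$ (i, i))"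

definition fold_queue :: "nat \<Rightarrow> 'v univ_data \<Rightarrow> int mat list \<Rightarrow> bool" where
  "fold_queue cap U Hs \<longleftrightarrow>
     distinct Hs \<and> set Hs = {H. hnf_basis (free_rank U) H \<and> fold_order U H \<le> cap} \<and>
     sorted (map (fold_order U) Hs)"

definition fold_host :: "'v univ_data \<Rightarrow> int mat \<Rightarrow> 'v host \<Rightarrow> bool" where
  "fold_host U H h \<longleftrightarrow>
     (let L = {\<one>\<^bsub>cyclic_product (torsion U)\<^esub>} \<times> row_lattice H;
          \<pi> = (\<lambda>x. L #>\<^bsub>split_group U\<^esub> x)
      in presents (split_group U Mod L) (\<pi> ` set (gens U)) (\<pi> \<circ> labels U) h)"

definition F2E :: "'v pair_pre_digraph \<Rightarrow> ('v set \<Rightarrow> int) monoid" where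
  "F2E G = product_group (uedges G) (\<lambda>_. integer_mod_group 2)"

definition binary_cycle_space :: "'v pair_pre_digraph \<Rightarrow> ('v set \<Rightarrow> int) set" where
  "binary_cycle_space G =
     {x \<in> carrier (F2E G). \<forall>v\<in>pverts G. even (\<Sum>e | e \<in> uedges G \<and> v \<in> e. x e)}"

definition edge_gen :: "'v pair_pre_digraph \<Rightarrow> 'v set \<Rightarrow> ('v set \<Rightarrow> int) set" where
  "edge_gen G e =
     binary_cycle_space G #>\<^bsub>F2E G\<^esub> (\<lambda>e'\<in>uedges G. if e' = e then 1 else 0)"

definition binary_host :: "'v pair_pre_digraph \<Rightarrow> 'v host \<Rightarrow> bool" where
  "binary_host G h \<longleftrightarrow>
     (let Q = F2E G Mod binary_cycle_space G in
       \<exists>l. path_labels G Q (\<lambda>(u, v). edge_gen G {u, v}) l \<and>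
           presents Q (edge_gen G ` uedges G) l h)"

text \<open>
  A transition system; every choice the algorithm leaves open is nondeterministic (the portfolio,
  cycle bases, roots and paths, Smith coordinates, the order among folds of equal host order, the
  peeled edge, ties in the final selection). In all states, \<open>R\<close> is the list of recorded hosts and
  \<open>Ps\<close> the list of initial partitions still to be processed.
\<close>

datatype 'v state =
    Start
  | Next "'v opart list" "'v host list"
  | Refine "'v opart" "'v opart list" "'v host list"
  | Search "'v opart" "'v univ_data" "int mat list" "'v opart list" "'v host list"
  | Select "'v host list"
  | Return "'v host"

inductive step :: "'v pair_pre_digraph \<Rightarrow> nat \<Rightarrow> 'v state \<Rightarrow> 'v state \<Rightarrow> bool"
  for G :: "'v pair_pre_digraph" and cap :: nat where
  portfolio:
    "\<forall>P\<in>set Ps. oriented_partition G P \<Longrightarrow> step G cap Start (Next Ps [])"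
| next_partition:
    "step G cap (Next (P # Ps) R) (Refine P Ps R)"
| compute_universal:
    "universal G P U \<Longrightarrow> fold_queue cap U Hs \<Longrightarrow>
     step G cap (Refine P Ps R) (Search P U Hs Ps R)"
| fold_pass:
    "fold_host U H h \<Longrightarrow> exact_check G h \<Longrightarrow>
     step G cap (Search P U (H # Hs) Ps R) (Next Ps (R @ [h]))"
| fold_fail:
    "fold_host U H h \<Longrightarrow> \<not> exact_check G h \<Longrightarrow>
     step G cap (Search P U (H # Hs) Ps R) (Search P U Hs Ps R)"
| leave:
    "all_singletons P \<Longrightarrow> step G cap (Search P U [] Ps R) (Next Ps R)"
| repair:
    "\<not> all_singletons P \<Longrightarrow> peel P P' \<Longrightarrow>
     step G cap (Search P U [] Ps R) (Refine P' Ps R)"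
| binary_terminal:
    "binary_host G h \<Longrightarrow>
     step G cap (Next [] R) (Select (if exact_check G h then R @ [h] else R))"
| select:
    "h \<in> set R \<Longrightarrow> \<forall>h'\<in>set R. order (host_group h) \<le> order (host_group h') \<Longrightarrow>
     step G cap (Select R) (Return h)"

end

theory Submission
  imports "Jordan_Normal_Form.Determinant" Defs
begin

text \<open>
  Termination is a lexicographic descent: every repair step adds a class to the current partition,
  and there are at most as many classes as edges. No state other than \<open>Return\<close> is stuck, because
  every finitely generated abelian group has Smith coordinates, every graph has an integral cycle
  basis, and a Hermite basis has positive determinant, so that folds are finite groups. A passed
  exact check is an isometric embedding, since distances in a connected graph never exceed the
  diameter.

  For the size bound it suffices that the binary host passes the exact check, because the smallest
  recorded host is returned. The boundary map identifies the binary quotient with the even vertex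
  sets, of which there are \<open>2\<^sup>n\<^sup>-\<^sup>1\<close>; the vertex \<open>v\<close> gets the label
  \<open>{r} + {v}\<close> and the edge \<open>{u, w}\<close> the generator \<open>{u, w}\<close>. A Cayley path of length \<open>k\<close> from \<open>u\<close>
  to \<open>v\<close> is thus a list of \<open>k\<close> edges with odd degree exactly at \<open>u\<close> and \<open>v\<close>, which contains a
  path of the graph from \<open>u\<close> to \<open>v\<close>.
\<close>

section \<open>Finitely generated abelian groups\<close>

text \<open>The search loop needs no theory of good folds. A fold may identify vertices or create
  shortcuts; all that is proved about it is that it is a finite group with a legal connection set
  and labels inside it, and the exact check does the rest. The price is progress: in every state the
  objects demanded by the next step must exist. Universal groups and fold quotients arise as bare
  quotients, so both need cyclic coordinates. One structure theorem, for any abelian group with a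
  finite generating set, is therefore read twice: a divisibility chain has its zeros at the end,
  which gives the splitting into \<open>T\<close> and a free part; and if every element has finite
  order, no modulus is zero, which gives a finite host. No fold is ever counted; only the binary
  quotient has its order bounded. The labels follow the same division: in the universal group it is
  enough that they are sums along some paths, while in the binary quotient their values matter, and
  the boundary map supplies them.\<close>

primrec lincomb :: "('g, 'm) monoid_scheme \<Rightarrow> 'g list \<Rightarrow> int list \<Rightarrow> 'g" where
  "lincomb Q [] ks = \<one>\<^bsub>Q\<^esub>"
| "lincomb Q (x # xs) ks = x [^]\<^bsub>Q\<^esub> hd ks \<otimes>\<^bsub>Q\<^esub> lincomb Q xs (tl ks)"

context comm_group
begin

lemma lincomb_closed [simp]: "set xs \<subseteq> carrier G \<Longrightarrow> lincomb G xs ks \<in> carrier G"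
  by (induction xs arbitrary: ks) auto

lemma lincomb_append:
  "set xs \<subseteq> carrier G \<Longrightarrow> set ys \<subseteq> carrier G \<Longrightarrow> length ks = length xs \<Longrightarrow>
   lincomb G (xs @ ys) (ks @ ls) = lincomb G xs ks \<otimes> lincomb G ys ls"
proof (induction xs arbitrary: ks)
  case (Cons x xs)
  then show ?case by (cases ks) (auto simp: m_assoc)
qed simp

lemma lincomb_add:
  "set xs \<subseteq> carrier G \<Longrightarrow> length ks = length xs \<Longrightarrow> length ls = length xs \<Longrightarrow>
   lincomb G xs (map2 (+) ks ls) = lincomb G xs ks \<otimes> lincomb G xs ls"
proof (induction xs arbitrary: ks ls)
  case (Cons x xs)
  then obtain k ks' l ls' where "ks = k # ks'" "ls = l # ls'"
    by (metis length_Suc_conv)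
  with Cons show ?case
    by (simp add: int_pow_mult m_ac)
qed simp

lemma lincomb_scale:
  "set xs \<subseteq> carrier G \<Longrightarrow> length ks = length xs \<Longrightarrow>
   lincomb G xs (map ((*) c) ks) = lincomb G xs ks [^] c"
proof (induction xs arbitrary: ks)
  case (Cons x xs)
  then obtain k ks' where "ks = k # ks'"
    by (metis length_Suc_conv)
  with Cons show ?case
    by (simp add: int_pow_distrib int_pow_pow mult.commute)
qed simp

lemma lincomb_zero:
  "set xs \<subseteq> carrier G \<Longrightarrow> lincomb G xs (replicate (length xs) 0) = \<one>"
  by (induction xs) auto

lemma lincomb_mem_subgroup:
  assumes "subgroup H G" "set xs \<subseteq> H"
  shows "lincomb G xs ks \<in> H"
  using assms(2)
  by (induction xs arbitrary: ks)
    (auto simp: assms(1) subgroup.one_closed subgroup.m_closed subgroup_int_pow_closed)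

lemma subgroup_lincombs:
  assumes "set xs \<subseteq> carrier G"
  shows "subgroup {lincomb G xs ks | ks. length ks = length xs} G" (is "subgroup ?S G")
proof (rule subgroupI)
  show "?S \<subseteq> carrier G" "?S \<noteq> {}"
    using assms by (auto intro: exI[of _ "replicate (length xs) 0"])
next
  fix a assume "a \<in> ?S"
  then obtain ks where ks: "length ks = length xs" "a = lincomb G xs ks" by auto
  have "inv a = lincomb G xs (map ((*) (-1)) ks)"
    using ks assms by (simp only: lincomb_scale int_pow_neg lincomb_closed int_pow_1)
  with ks show "inv a \<in> ?S" by (intro CollectI exI[of _ "map ((*) (-1)) ks"]) auto
next
  fix a b assume "a \<in> ?S" "b \<in> ?S"
  then obtain ks ls where "length ks = length xs" "a = lincomb G xs ks"
      "length ls = length xs" "b = lincomb G xs ls"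
    by blast
  then show "a \<otimes> b \<in> ?S"
    using assms by (auto intro!: exI[of _ "map2 (+) ks ls"] simp: lincomb_add)
qed

lemma mem_set_imp_lincomb:
  assumes "set xs \<subseteq> carrier G" "x \<in> set xs"
  shows "\<exists>ks. length ks = length xs \<and> x = lincomb G xs ks"
proof -
  obtain as bs where xs: "xs = as @ x # bs" using assms(2) by (meson split_list)
  have "lincomb G xs (replicate (length as) 0 @ 1 # replicate (length bs) 0) = x"
    using assms(1) unfolding xs by (auto simp: lincomb_append lincomb_zero)
  then show ?thesis
    by (metis xs length_append length_replicate length_Cons)
qed

lemma generate_eq_lincombs:
  assumes "set xs \<subseteq> carrier G"
  shows "generate G (set xs) = {lincomb G xs ks | ks. length ks = length xs}"
proof
  show "generate G (set xs) \<subseteq> {lincomb G xs ks | ks. length ks = length xs}"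
    using mem_set_imp_lincomb[OF assms]
    by (intro generate_subgroup_incl subgroup_lincombs assms) blast
  show "{lincomb G xs ks | ks. length ks = length xs} \<subseteq> generate G (set xs)"
    using lincomb_mem_subgroup[OF generate_is_subgroup[OF assms]] generate.incl by fastforce
qed

section \<open>Change of generators and Smith normal form\<close>

lemma generate_eqI:
  assumes "A \<subseteq> carrier G" "B \<subseteq> carrier G" "A \<subseteq> generate G B" "B \<subseteq> generate G A"
  shows "generate G A = generate G B"
  by (meson assms generate_is_subgroup generate_subgroup_incl subset_antisym)

lemma generate_insert_cong:
  assumes "x \<in> carrier G" "A \<subseteq> carrier G" "B \<subseteq> carrier G" "generate G A = generate G B"
  shows "generate G (insert x A) = generate G (insert x B)"
proof (rule generate_eqI)
  have "A \<subseteq> generate G A" "B \<subseteq> generate G B"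
    by (simp_all add: generate.incl subsetI)
  then have "A \<subseteq> generate G B" "B \<subseteq> generate G A"
    by (simp_all add: assms(4))
  then show "insert x A \<subseteq> generate G (insert x B)" "insert x B \<subseteq> generate G (insert x A)"
    using mono_generate[of A "insert x A"] mono_generate[of B "insert x B"]
      generate.incl[of x "insert x A"] generate.incl[of x "insert x B"]
    by blast+
qed (use assms in auto)

text \<open>Dividing by \<open>a\<close>, which the remaining generators supply, recovers
  \<open>x\<close>. This is the elementary operation of the reduction; reordering needs no
  counterpart, because \<open>generate\<close> sees only the set.\<close>

lemma generate_insert_translate:
  assumes "x \<in> carrier G" "A \<subseteq> carrier G" "a \<in> generate G A"
  shows "generate G (insert (x \<otimes> a) A) = generate G (insert x A)"
proof (rule generate_eqI)
  have a: "a \<in> carrier G" using assms generate_in_carrier by blast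
  then show "insert (x \<otimes> a) A \<subseteq> carrier G" using assms by auto
  have *: "a \<in> generate G (insert y A)" for y
    using assms(3) mono_generate[of A "insert y A"] by blast
  show "insert (x \<otimes> a) A \<subseteq> generate G (insert x A)"
    using * generate.eng[OF generate.incl[of x "insert x A"], of a] generate.incl[of _ "insert x A"]
    by blast
  have "(x \<otimes> a) \<otimes> inv a \<in> generate G (insert (x \<otimes> a) A)"
    using * a assms by (intro generate.eng[OF generate.incl] generate_m_inv_closed) auto
  moreover have "(x \<otimes> a) \<otimes> inv a = x"
    using a assms(1) by (simp add: m_assoc)
  ultimately show "insert x A \<subseteq> generate G (insert (x \<otimes> a) A)"
    using generate.incl[of _ "insert (x \<otimes> a) A"] by auto
qed (use assms in auto)

text \<open>The generating list is quantified inside, so a change of generators never leaves the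
  predicate. The least positive \<open>d\<close> is thus a minimum over all relations of all
  generating lists of length \<open>n\<close>: the first invariant factor of \<open>S\<close> when
  it is presented on \<open>n\<close> generators.\<close>

definition relation_coeff :: "'a set \<Rightarrow> nat \<Rightarrow> int \<Rightarrow> bool" where
  "relation_coeff S n d \<longleftrightarrow>
     (\<exists>xs ks. length xs = n \<and> length ks = n \<and> set xs \<subseteq> carrier G \<and> generate G (set xs) = S \<and>
        lincomb G xs ks = \<one> \<and> d \<in> set ks)"

lemma relation_coeff_uminus:
  assumes "relation_coeff S n d" shows "relation_coeff S n (- d)"
proof -
  obtain xs ks where *: "length xs = n" "length ks = n" "set xs \<subseteq> carrier G"
      "generate G (set xs) = S" "lincomb G xs ks = \<one>" "d \<in> set ks"
    using assms unfolding relation_coeff_def by blast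
  have "lincomb G xs (map ((*) (-1)) ks) = \<one>"
    using * by (simp only: lincomb_scale int_pow_one)
  with * show ?thesis unfolding relation_coeff_def
    by (intro exI[of _ xs] exI[of _ "map ((*) (-1)) ks"]) auto
qed

lemma relation_coeff_front:
  assumes "relation_coeff S (Suc n) d"
  obtains x xs ks where "length xs = n" "length ks = n" "x \<in> carrier G" "set xs \<subseteq> carrier G"
    "generate G (insert x (set xs)) = S" "lincomb G (x # xs) (d # ks) = \<one>"
proof -
  obtain xs ks where *: "length xs = Suc n" "length ks = Suc n" "set xs \<subseteq> carrier G"
      "generate G (set xs) = S" "lincomb G xs ks = \<one>" "d \<in> set ks"
    using assms unfolding relation_coeff_def by blast
  obtain ks1 ks2 where ks: "ks = ks1 @ d # ks2" using *(6) by (meson split_list)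
  define xs1 where "xs1 = take (length ks1) xs"
  obtain x xs2 where x: "drop (length ks1) xs = x # xs2"
    using * ks by (cases "drop (length ks1) xs") auto
  have xs: "xs = xs1 @ x # xs2" unfolding xs1_def using x by (metis append_take_drop_id)
  have len: "length ks1 = length xs1" using * ks unfolding xs1_def by auto
  show thesis
  proof (rule that[of "xs1 @ xs2" "ks1 @ ks2" x])
    show "lincomb G (x # xs1 @ xs2) (d # ks1 @ ks2) = \<one>"
      using *(3,5) len unfolding xs ks by (simp add: lincomb_append m_ac)
  qed (use * xs ks in auto)
qed

text \<open>
  Reducing a coefficient modulo another one is a base change of the generators; so a minimal
  positive coefficient divides all the others.
\<close>

lemma minimal_coeff_dvd:
  assumes min: "\<And>k. relation_coeff S (Suc n) k \<Longrightarrow> 0 < k \<Longrightarrow> int d \<le> k"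
    and "0 < d" "length xs = n" "length ks = n" "x \<in> carrier G" "set xs \<subseteq> carrier G"
    and gen: "generate G (insert x (set xs)) = S" and rel: "lincomb G (x # xs) (int d # ks) = \<one>"
    and "b \<in> set ks"
  shows "int d dvd b"
proof -
  obtain ks1 ks2 where ks: "ks = ks1 @ b # ks2" using \<open>b \<in> set ks\<close> by (meson split_list)
  define xs1 where "xs1 = take (length ks1) xs"
  obtain y xs2 where y: "drop (length ks1) xs = y # xs2"
    using assms ks by (cases "drop (length ks1) xs") auto
  have xs: "xs = xs1 @ y # xs2" unfolding xs1_def using y by (metis append_take_drop_id)
  have len: "length ks1 = length xs1" "length ks2 = length xs2"
    using assms(3,4) ks y length_drop[of "length ks1" xs] unfolding xs1_def by auto
  define q r where "q = b div int d" and "r = b mod int d"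
  have b: "b = q * int d + r" unfolding q_def r_def by simp
  have car: "y \<in> carrier G" "set xs1 \<subseteq> carrier G" "set xs2 \<subseteq> carrier G"
    using assms xs by auto
  \<comment> \<open>Since \<open>b = q * int d + r\<close>, the power of \<open>y\<close> with
    exponent \<open>q * int d\<close> can be moved into the \<open>d\<close>-th power of the new
    generator; \<open>y\<close> keeps only the exponent \<open>r\<close>.\<close>
  have "lincomb G ((x \<otimes> y [^] q) # xs) (int d # ks1 @ r # ks2) = lincomb G (x # xs) (int d # ks)"
    unfolding xs ks b using car len \<open>x \<in> carrier G\<close>
    by (simp add: lincomb_append int_pow_mult int_pow_distrib int_pow_pow m_ac)
  moreover have "generate G (insert (x \<otimes> y [^] q) (set xs)) = S"
  proof -
    have "y [^] q \<in> generate G (set xs)"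
      using assms xs by (intro subgroup_int_pow_closed generate_is_subgroup) (auto intro: generate.incl)
    then show ?thesis using generate_insert_translate assms gen by simp
  qed
  ultimately have "relation_coeff S (Suc n) r"
    unfolding relation_coeff_def using rel car assms ks
    by (intro exI[of _ "(x \<otimes> y [^] q) # xs"] exI[of _ "int d # ks1 @ r # ks2"]) auto
  moreover have "0 \<le> r" "r < int d"
    using \<open>0 < d\<close> unfolding r_def by auto
  ultimately have "r = 0"
    using min[of r] by linarith
  then show ?thesis unfolding r_def by auto
qed

text \<open>Among all relations of all generating lists of this length, one with the least positive
  coefficient \<open>d\<close> can be turned into \<open>d\<close> times a single generator. The
  other generators are treated by induction, and minimality once more forces \<open>d\<close> to
  divide every later modulus. If all relations are trivial, the generators are free and every
  modulus is \<open>0\<close>. The last clause says that the relations among \<open>zs\<close> are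
  exactly the diagonal ones.\<close>

lemma smith_generators:
  assumes "set xs \<subseteq> carrier G" "length xs = n"
  shows "\<exists>zs (ds :: nat list). length zs = n \<and> length ds = n \<and> set zs \<subseteq> carrier G \<and>
    generate G (set zs) = generate G (set xs) \<and> sorted_wrt (dvd) ds \<and>
    (\<forall>ks. length ks = n \<longrightarrow> (lincomb G zs ks = \<one> \<longleftrightarrow> list_all2 (\<lambda>d k. int d dvd k) ds ks))"
  using assms
proof (induction n arbitrary: xs)
  case 0
  then show ?case by auto
next
  case (Suc m)
  define S where "S = generate G (set xs)"
  show ?case
  proof (cases "\<exists>k. relation_coeff S (Suc m) k \<and> k \<noteq> 0")
    case False
    have "lincomb G xs ks = \<one> \<longleftrightarrow> list_all2 (\<lambda>d k. int d dvd k) (replicate (Suc m) 0) ks"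
      if "length ks = Suc m" for ks
    proof
      assume "lincomb G xs ks = \<one>"
      then have "\<forall>k\<in>set ks. k = 0"
        using False that Suc.prems unfolding relation_coeff_def S_def by blast
      then show "list_all2 (\<lambda>d k. int d dvd k) (replicate (Suc m) 0) ks"
        using that by (simp add: list_all2_conv_all_nth del: replicate_Suc)
    next
      assume "list_all2 (\<lambda>d k. int d dvd k) (replicate (Suc m) 0) ks"
      then have "ks = replicate (length xs) 0"
        using that Suc.prems by (simp add: list_all2_conv_all_nth list_eq_iff_nth_eq del: replicate_Suc)
      then show "lincomb G xs ks = \<one>"
        using Suc.prems lincomb_zero by metis
    qed
    moreover have "sorted_wrt (dvd) (replicate (Suc m) (0::nat))"
      by (simp add: sorted_wrt_iff_nth_less del: replicate_Suc)
    ultimately show ?thesis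
      using Suc.prems by (intro exI[of _ xs] exI[of _ "replicate (Suc m) 0"]) auto
  next
    case True
    then obtain k where "relation_coeff S (Suc m) k" "0 < k"
      using relation_coeff_uminus by (metis linorder_neqE neg_0_less_iff_less)
    then have ex: "relation_coeff S (Suc m) (int (nat k)) \<and> 0 < nat k" by auto
    define d where "d = (LEAST d. relation_coeff S (Suc m) (int d) \<and> 0 < d)"
    have d: "relation_coeff S (Suc m) (int d)" "0 < d"
      using LeastI[of "\<lambda>d. relation_coeff S (Suc m) (int d) \<and> 0 < d", OF ex] unfolding d_def by auto
    have min: "int d \<le> k" if "relation_coeff S (Suc m) k" "0 < k" for k
    proof -
      have "d \<le> nat k" unfolding d_def using that by (intro Least_le) auto
      then show ?thesis using that by linarith
    qed
    obtain x ys ks where ys: "length ys = m" "length ks = m" "x \<in> carrier G" "set ys \<subseteq> carrier G"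
        "generate G (insert x (set ys)) = S" "lincomb G (x # ys) (int d # ks) = \<one>"
      by (rule relation_coeff_front[OF d(1)])
    have dvd: "int d dvd b" if "b \<in> set ks" for b
      using minimal_coeff_dvd[OF min d(2) ys that] .
    define qs where "qs = map (\<lambda>b. b div int d) ks"
    have ks: "ks = map ((*) (int d)) qs"
      unfolding qs_def using dvd by (simp add: map_idI)
    \<comment> \<open>The other coefficients are \<open>d\<close> times the entries of
      \<open>qs\<close>, so the minimal relation says that \<open>d\<close> annihilates this
      element. It takes the place of \<open>x\<close>.\<close>
    define x' where "x' = x \<otimes> lincomb G ys qs"
    have x': "x' \<in> carrier G" unfolding x'_def using ys by simp
    have x'_d: "x' [^] int d = \<one>"
      using ys(6) ys(1-4) unfolding ks x'_def by (simp add: lincomb_scale int_pow_distrib)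
    obtain zs ds where zs: "length zs = m" "length ds = m" "set zs \<subseteq> carrier G"
        "generate G (set zs) = generate G (set ys)" "sorted_wrt (dvd) ds"
        "\<And>ks. length ks = m \<Longrightarrow> lincomb G zs ks = \<one> \<longleftrightarrow> list_all2 (\<lambda>d k. int d dvd k) ds ks"
      using Suc.IH[OF ys(4,1)] by blast
    have gen: "generate G (insert x' (set zs)) = S"
    proof -
      have "generate G (insert x' (set zs)) = generate G (insert x' (set ys))"
        using x' ys zs by (intro generate_insert_cong)
      also have "\<dots> = generate G (insert x (set ys))"
        unfolding x'_def using ys
        by (intro generate_insert_translate lincomb_mem_subgroup[OF generate_is_subgroup])
          (auto intro: generate.incl)
      finally show ?thesis using ys by simp
    qed
    \<comment> \<open>Adding the diagonal relations gives one relation whose coefficients are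
      \<open>d\<close> and all of \<open>ds\<close>, so minimality yields the divisibility
      chain.\<close>
    have "list_all2 (\<lambda>d k. int d dvd k) ds (map int ds)"
      by (simp add: list_all2_conv_all_nth)
    then have rel: "lincomb G (x' # zs) (int d # map int ds) = \<one>"
      using x'_d zs(2) zs(6)[of "map int ds"] by simp
    have "d dvd b" if "b \<in> set ds" for b
    proof -
      have "int b \<in> set (map int ds)" "length (map int ds) = m"
        using that zs(2) by auto
      then have "int d dvd int b"
        using minimal_coeff_dvd[OF min d(2) zs(1) _ x' zs(3) gen rel] by blast
      then show ?thesis by simp
    qed
    then have "sorted_wrt (dvd) (d # ds)" using zs(5) by auto
    moreover have "lincomb G (x' # zs) ks = \<one> \<longleftrightarrow> list_all2 (\<lambda>d k. int d dvd k) (d # ds) ks"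
      if len: "length ks = Suc m" for ks
    proof -
      obtain l ls where ls: "ks = l # ls" "length ls = m" using len by (metis length_Suc_conv)
      have x'_pow: "x' [^] l = x' [^] (l mod int d)" for l
      proof -
        have "x' [^] (int d * (l div int d) + l mod int d) =
            (x' [^] int d) [^] (l div int d) \<otimes> x' [^] (l mod int d)"
          using x' by (simp only: int_pow_mult int_pow_pow)
        then show ?thesis using x' x'_d by simp
      qed
      show ?thesis
      proof
        assume rel: "lincomb G (x' # zs) ks = \<one>"
        \<comment> \<open>As \<open>d\<close> annihilates \<open>x'\<close>, its coefficient counts
          only modulo \<open>d\<close>, and a nonzero remainder would lie below the minimum. Hence
          the \<open>x'\<close> term drops out and \<open>ls\<close> is a relation of
          \<open>zs\<close>.\<close>
        then have "lincomb G (x' # zs) ((l mod int d) # ls) = \<one>"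
          using x'_pow[of l] ls by simp
        then have "relation_coeff S (Suc m) (l mod int d)"
          unfolding relation_coeff_def using zs x' gen ls
          by (intro exI[of _ "x' # zs"] exI[of _ "(l mod int d) # ls"]) auto
        moreover have "0 \<le> l mod int d" "l mod int d < int d"
          using \<open>0 < d\<close> by auto
        ultimately have "l mod int d = 0"
          using min[of "l mod int d"] by linarith
        then show "list_all2 (\<lambda>d k. int d dvd k) (d # ds) ks"
          using rel ls zs x'_pow[of l] by (auto simp: dvd_eq_mod_eq_0)
      next
        assume "list_all2 (\<lambda>d k. int d dvd k) (d # ds) ks"
        then show "lincomb G (x' # zs) ks = \<one>"
          using ls zs x'_pow[of l] by auto
      qed
    qed
    ultimately show ?thesis
      using zs x' gen S_def
      by (intro exI[of _ "x' # zs"] exI[of _ "d # ds"]) auto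
  qed
qed

end

section \<open>Products of cyclic groups as coordinates\<close>

lemma comm_group_product_group:
  assumes "\<And>i. i \<in> I \<Longrightarrow> comm_group (F i)"
  shows "comm_group (product_group I F)"
proof (rule group.group_comm_groupI)
  show "group (product_group I F)"
    using assms by (simp add: comm_group.axioms(2))
  fix x y assume *: "x \<in> carrier (product_group I F)" "y \<in> carrier (product_group I F)"
  have "x i \<otimes>\<^bsub>F i\<^esub> y i = y i \<otimes>\<^bsub>F i\<^esub> x i" if "i \<in> I" for i
  proof -
    interpret comm_group "F i" using assms that .
    show ?thesis using * that by (intro m_comm) auto
  qed
  then show "x \<otimes>\<^bsub>product_group I F\<^esub> y = y \<otimes>\<^bsub>product_group I F\<^esub> x"
    by (auto intro: restrict_ext)
qed

lemma comm_group_cyclic_product: "comm_group (cyclic_product Ns)"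
  unfolding cyclic_product_def by (rule comm_group_product_group) simp

lemma finite_cyclic_product:
  assumes "0 \<notin> set Ns" shows "finite (carrier (cyclic_product Ns))"
proof -
  have "finite (carrier (integer_mod_group (Ns ! i)))" if "i < length Ns" for i
    using assms that by (metis carrier_integer_mod_group finite_atLeastLessThan_int nth_mem)
  then show ?thesis
    unfolding cyclic_product_def by (auto intro: finite_PiE)
qed

text \<open>With modulus 0, the integers become one of the cyclic groups, so facts about
  \<open>cyclic_product\<close> apply to free parts and lattices as well.\<close>

lemma integer_group_eq_mod_0: "integer_group = integer_mod_group 0"
  by (simp add: integer_mod_group_def)

lemma Zpow_eq_cyclic_product: "Zpow t = cyclic_product (replicate t 0)"
  unfolding Zpow_def cyclic_product_def product_group_def integer_group_eq_mod_0
  by (auto simp: fun_eq_iff intro!: PiE_cong)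

lemma comm_group_Zpow: "comm_group (Zpow t)"
  by (simp add: Zpow_eq_cyclic_product comm_group_cyclic_product)

lemma carrier_Zpow: "carrier (Zpow t) = extensional {..<t}"
  by (auto simp: Zpow_def PiE_def)

lemma nat_pow_product_group:
  assumes "i \<in> I"
  shows "(x [^]\<^bsub>product_group I F\<^esub> (m::nat)) i = x i [^]\<^bsub>F i\<^esub> m"
  using assms by (induction m) auto

context comm_group
begin

lemma lincomb_eq_iff:
  assumes "set zs \<subseteq> carrier G" "length ks = length zs" "length ls = length zs"
  shows "lincomb G zs ks = lincomb G zs ls \<longleftrightarrow> lincomb G zs (map2 (-) ks ls) = \<one>"
proof -
  have "ks = map2 (+) (map2 (-) ks ls) ls"
    using assms by (auto intro: nth_equalityI)
  then have "lincomb G zs ks = lincomb G zs (map2 (-) ks ls) \<otimes> lincomb G zs ls"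
    using assms lincomb_add[of zs "map2 (-) ks ls" ls] by simp
  then show ?thesis
    using assms by simp
qed

text \<open>The map from integer vectors to combinations of Smith generators identifies two vectors
  exactly when they agree modulo \<open>ds\<close>. On canonical residues it is therefore bijective,
  and its inverse is the isomorphism.\<close>

lemma ex_iso_cyclic_product:
  assumes "finite X" "X \<subseteq> carrier G" "generate G X = carrier G"
  shows "\<exists>ds \<theta>. sorted_wrt (dvd) ds \<and> \<theta> \<in> iso G (cyclic_product ds)"
proof -
  obtain xs where xs: "set xs = X" using assms(1) finite_list by blast
  define n where "n = length xs"
  obtain zs and ds :: "nat list" where zs: "length zs = n" "length ds = n" "set zs \<subseteq> carrier G"
      "generate G (set zs) = carrier G" "sorted_wrt (dvd) ds"
      "\<And>ks. length ks = n \<Longrightarrow> lincomb G zs ks = \<one> \<longleftrightarrow> list_all2 (\<lambda>d k. int d dvd k) ds ks"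
    using smith_generators[of xs n] xs assms n_def by auto
  define L where "L y = lincomb G zs (map y [0..<n])" for y
  have L_eq: "L y = L y' \<longleftrightarrow> (\<forall>i<n. int (ds ! i) dvd y i - y' i)" for y y'
    unfolding L_def using zs
    by (simp add: lincomb_eq_iff list_all2_conv_all_nth)
  have L_add: "L (\<lambda>i. y i + y' i) = L y \<otimes> L y'" for y y'
  proof -
    have "map (\<lambda>i. y i + y' i) [0..<n] = map2 (+) (map y [0..<n]) (map y' [0..<n])"
      by (auto intro: nth_equalityI)
    then show ?thesis
      unfolding L_def using zs by (simp add: lincomb_add)
  qed
  have carr: "carrier (cyclic_product ds) = (\<Pi>\<^sub>E i\<in>{..<n}. if ds ! i = 0 then UNIV else {0..<int (ds ! i)})"
    using zs by (simp add: cyclic_product_def carrier_integer_mod_group cong: PiE_cong)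
  have "L \<in> iso (cyclic_product ds) G"
  proof (rule isoI)
    show "L \<in> hom (cyclic_product ds) G"
    proof (rule homI)
      show "L y \<in> carrier G" for y unfolding L_def using zs by simp
      fix y y'
      \<comment> \<open>The product group reduces the sum modulo \<open>ds\<close>, a change that
        \<open>L\<close> does not see.\<close>
      have "L (y \<otimes>\<^bsub>cyclic_product ds\<^esub> y') = L (\<lambda>i. y i + y' i)"
        using zs by (auto simp: L_eq cyclic_product_def minus_mod_eq_mult_div[symmetric]
          mod_eq_dvd_iff[symmetric])
      then show "L (y \<otimes>\<^bsub>cyclic_product ds\<^esub> y') = L y \<otimes> L y'" by (simp add: L_add)
    qed
    show "bij_betw L (carrier (cyclic_product ds)) (carrier G)"
    proof (rule bij_betw_imageI)
      show "inj_on L (carrier (cyclic_product ds))"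
      proof (rule inj_onI)
        fix y y' assume y: "y \<in> carrier (cyclic_product ds)" "y' \<in> carrier (cyclic_product ds)"
          and "L y = L y'"
        then have dvd: "int (ds ! i) dvd y i - y' i" if "i < n" for i
          using that by (simp add: L_eq)
        show "y = y'"
        proof (rule PiE_ext[OF y[unfolded carr]])
          fix i assume i: "i \<in> {..<n}"
          then have "y i mod int (ds ! i) = y' i mod int (ds ! i)"
            using dvd by (simp add: mod_eq_dvd_iff)
          then show "y i = y' i"
            using PiE_mem[OF y(1)[unfolded carr] i] PiE_mem[OF y(2)[unfolded carr] i]
            by (auto split: if_splits)
        qed
      qed
      show "L ` carrier (cyclic_product ds) = carrier G"
      proof
        show "L ` carrier (cyclic_product ds) \<subseteq> carrier G"
          unfolding L_def using zs by auto
        show "carrier G \<subseteq> L ` carrier (cyclic_product ds)"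
        proof
          fix g assume "g \<in> carrier G"
          then obtain ks where ks: "length ks = n" "g = lincomb G zs ks"
            using generate_eq_lincombs[OF zs(3)] zs(1,4) by auto
          have "map ((!) ks) [0..<n] = ks" using ks(1) map_nth by blast
          then have "g = L ((!) ks)" unfolding L_def using ks(2) by simp
          \<comment> \<open>Reduction modulo \<open>0\<close> is the identity, so free coordinates
            keep their value and the others become canonical residues.\<close>
          also have "\<dots> = L (\<lambda>i\<in>{..<n}. ks ! i mod int (ds ! i))"
            by (auto simp: L_eq)
          finally have "g = L (\<lambda>i\<in>{..<n}. ks ! i mod int (ds ! i))" .
          moreover have "(\<lambda>i\<in>{..<n}. ks ! i mod int (ds ! i)) \<in> carrier (cyclic_product ds)"
            unfolding carr by auto
          ultimately show "g \<in> L ` carrier (cyclic_product ds)" by blast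
        qed
      qed
    qed
  qed
  then have "inv_into (carrier (cyclic_product ds)) L \<in> iso G (cyclic_product ds)"
    by (intro group.iso_set_sym comm_group.axioms(2) comm_group_cyclic_product)
  then show ?thesis using zs(5) by blast
qed

end

text \<open>\<open>0\<close> divides only \<open>0\<close>, so in a divisibility chain everything
  after the first zero is zero.\<close>

lemma sorted_dvd_split_zeros:
  "sorted_wrt (dvd) (ds :: nat list) \<Longrightarrow>
   \<exists>ts f. ds = ts @ replicate f 0 \<and> 0 \<notin> set ts \<and> sorted_wrt (dvd) ts"
proof (induction ds)
  case (Cons d ds)
  show ?case
  proof (cases "d = 0")
    case True
    then have "d # ds = [] @ replicate (Suc (length ds)) 0"
      using Cons.prems by (auto intro: replicate_eqI)
    then show ?thesis by (metis empty_iff list.set(1) sorted_wrt.simps(1))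
  next
    case False
    obtain ts f where "ds = ts @ replicate f 0" "0 \<notin> set ts" "sorted_wrt (dvd) ts"
      using Cons by auto
    then show ?thesis
      using False Cons.prems by (intro exI[of _ "d # ts"] exI[of _ f]) auto
  qed
qed simp

lemma ex_iso_cyclic_product_Zpow:
  "\<exists>\<theta>. \<theta> \<in> iso (cyclic_product (ts @ replicate f 0)) (cyclic_product ts \<times>\<times> Zpow f)"
proof
  define k where "k = length ts"
  define C where "C = cyclic_product (ts @ replicate f 0)"
  define \<theta> :: "(nat \<Rightarrow> int) \<Rightarrow> (nat \<Rightarrow> int) \<times> (nat \<Rightarrow> int)"
    where "\<theta> y = (\<lambda>i\<in>{..<k}. y i, \<lambda>i\<in>{..<f}. y (k + i))" for y
  define \<eta> :: "(nat \<Rightarrow> int) \<times> (nat \<Rightarrow> int) \<Rightarrow> (nat \<Rightarrow> int)"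
    where "\<eta> = (\<lambda>(a, b). \<lambda>i\<in>{..<k+f}. if i < k then a i else b (i - k))"
  have carr_C: "carrier C = (\<Pi>\<^sub>E i\<in>{..<k+f}. if i < k then carrier (integer_mod_group (ts ! i)) else UNIV)"
    by (auto simp: C_def cyclic_product_def k_def nth_append carrier_integer_mod_group intro!: PiE_cong)
  have carr: "carrier (cyclic_product ts \<times>\<times> Zpow f) =
      (\<Pi>\<^sub>E i\<in>{..<k}. carrier (integer_mod_group (ts ! i))) \<times> (\<Pi>\<^sub>E i\<in>{..<f}. UNIV)"
    by (simp add: DirProd_def cyclic_product_def Zpow_def k_def)
  show "\<theta> \<in> iso (cyclic_product (ts @ replicate f 0)) (cyclic_product ts \<times>\<times> Zpow f)"
    unfolding C_def[symmetric]
  proof (rule isoI)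
    show "\<theta> \<in> hom C (cyclic_product ts \<times>\<times> Zpow f)"
    proof (rule homI)
      fix y assume y: "y \<in> carrier C"
      have "y i \<in> carrier (integer_mod_group (ts ! i))" if "i < k" for i
        using PiE_mem[OF y[unfolded carr_C], of i] that by simp
      then show "\<theta> y \<in> carrier (cyclic_product ts \<times>\<times> Zpow f)"
        unfolding carr \<theta>_def by auto
      fix y'
      show "\<theta> (y \<otimes>\<^bsub>C\<^esub> y') = \<theta> y \<otimes>\<^bsub>cyclic_product ts \<times>\<times> Zpow f\<^esub> \<theta> y'"
        unfolding \<theta>_def C_def
        by (auto simp: cyclic_product_def Zpow_def k_def nth_append intro!: restrict_ext)
    qed
    show "bij_betw \<theta> (carrier C) (carrier (cyclic_product ts \<times>\<times> Zpow f))"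
    proof (rule bij_betw_byWitness[where f' = \<eta>])
      show "\<forall>y\<in>carrier C. \<eta> (\<theta> y) = y"
      proof
        fix y assume "y \<in> carrier C"
        then have "y \<in> extensional {..<k+f}" unfolding carr_C PiE_def by blast
        then show "\<eta> (\<theta> y) = y"
          unfolding \<eta>_def \<theta>_def by (auto simp: extensional_def)
      qed
      show "\<forall>p\<in>carrier (cyclic_product ts \<times>\<times> Zpow f). \<theta> (\<eta> p) = p"
      proof
        fix p assume p: "p \<in> carrier (cyclic_product ts \<times>\<times> Zpow f)"
        obtain a b where ab: "p = (a, b)" by (cases p)
        have "a \<in> extensional {..<k}" "b \<in> extensional {..<f}"
          using p unfolding carr ab PiE_def by blast+
        then show "\<theta> (\<eta> p) = p"
          unfolding ab \<eta>_def \<theta>_def by (auto simp: extensional_def restrict_def)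
      qed
      show "\<theta> ` carrier C \<subseteq> carrier (cyclic_product ts \<times>\<times> Zpow f)"
      proof
        fix p assume "p \<in> \<theta> ` carrier C"
        then obtain y where y: "y \<in> carrier C" "p = \<theta> y" by blast
        have "y i \<in> carrier (integer_mod_group (ts ! i))" if "i < k" for i
          using PiE_mem[OF y(1)[unfolded carr_C], of i] that by simp
        then show "p \<in> carrier (cyclic_product ts \<times>\<times> Zpow f)"
          unfolding y(2) carr \<theta>_def by auto
      qed
      show "\<eta> ` carrier (cyclic_product ts \<times>\<times> Zpow f) \<subseteq> carrier C"
      proof
        fix y assume "y \<in> \<eta> ` carrier (cyclic_product ts \<times>\<times> Zpow f)"
        then obtain a b where ab: "a \<in> (\<Pi>\<^sub>E i\<in>{..<k}. carrier (integer_mod_group (ts ! i)))"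
            "y = \<eta> (a, b)"
          unfolding carr by blast
        have "a i \<in> carrier (integer_mod_group (ts ! i))" if "i < k" for i
          using PiE_mem[OF ab(1), of i] that by simp
        then show "y \<in> carrier C"
          unfolding ab(2) carr_C \<eta>_def by auto
      qed
    qed
  qed
qed

lemma (in comm_group) ex_iso_torsion_free_split:
  assumes "finite X" "X \<subseteq> carrier G" "generate G X = carrier G"
  shows "\<exists>ts f \<theta>. 0 \<notin> set ts \<and> sorted_wrt (dvd) ts \<and> \<theta> \<in> iso G (cyclic_product ts \<times>\<times> Zpow f)"
proof -
  obtain ds \<theta> where ds: "sorted_wrt (dvd) ds" "\<theta> \<in> iso G (cyclic_product ds)"
    using ex_iso_cyclic_product[OF assms] by blast
  obtain ts f where ts: "ds = ts @ replicate f 0" "0 \<notin> set ts" "sorted_wrt (dvd) ts"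
    using sorted_dvd_split_zeros[OF ds(1)] by blast
  obtain \<theta>' where "\<theta>' \<in> iso (cyclic_product ds) (cyclic_product ts \<times>\<times> Zpow f)"
    using ex_iso_cyclic_product_Zpow ts(1) by blast
  then have "\<theta>' \<circ> \<theta> \<in> iso G (cyclic_product ts \<times>\<times> Zpow f)"
    using iso_set_trans ds(2) by blast
  then show ?thesis using ts by blast
qed

text \<open>A zero modulus would be an infinite cyclic factor, and the preimage of its unit vector
  would have infinite order. A fold is thus seen to be finite without computing its order: an
  annihilating exponent for each element is enough.\<close>

lemma (in comm_group) ex_iso_finite_cyclic_product:
  assumes "finite X" "X \<subseteq> carrier G" "generate G X = carrier G"
    and torsion: "\<And>x. x \<in> carrier G \<Longrightarrow> \<exists>m::nat. 0 < m \<and> x [^] m = \<one>"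
  shows "\<exists>Ns \<theta>. 0 \<notin> set Ns \<and> \<theta> \<in> iso G (cyclic_product Ns)"
proof -
  obtain ds \<theta> where ds: "\<theta> \<in> iso G (cyclic_product ds)"
    using ex_iso_cyclic_product[OF assms(1-3)] by blast
  interpret C: comm_group "cyclic_product ds" by (rule comm_group_cyclic_product)
  interpret group_hom G "cyclic_product ds" \<theta>
    using ds by unfold_locales (simp add: iso_imp_homomorphism)
  have "ds ! i \<noteq> 0" if i: "i < length ds" for i
  proof
    assume 0: "ds ! i = 0"
    define e :: "nat \<Rightarrow> int" where "e = (\<lambda>j\<in>{..<length ds}. if j = i then 1 else 0)"
    have "e \<in> carrier (cyclic_product ds)"
      unfolding e_def cyclic_product_def using 0 by (auto simp: carrier_integer_mod_group)
    then obtain x where x: "x \<in> carrier G" "e = \<theta> x"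
      using ds by (metis Group.iso_iff imageE)
    obtain m :: nat where m: "0 < m" "x [^] m = \<one>" using torsion x(1) by blast
    have "e [^]\<^bsub>cyclic_product ds\<^esub> m = \<one>\<^bsub>cyclic_product ds\<^esub>"
      using m(2) x hom_nat_pow hom_one by metis
    then have "(e [^]\<^bsub>cyclic_product ds\<^esub> m) i = 0"
      using i by (simp add: cyclic_product_def)
    moreover have "(e [^]\<^bsub>cyclic_product ds\<^esub> m) i = int m"
      unfolding cyclic_product_def using i 0 by (simp add: nat_pow_product_group e_def)
    ultimately show False using m(1) by simp
  qed
  then have "0 \<notin> set ds" by (auto simp: in_set_conv_nth)
  with ds show ?thesis by blast
qed

section \<open>Distances and breadth-first search\<close>

context pair_wf_digraph
begin

lemma relpow_imp_awalk:
  "(u, v) \<in> parcs G ^^ k \<Longrightarrow> u \<in> pverts G \<Longrightarrow> \<exists>p. awalk u p v \<and> length p = k"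
proof (induction k arbitrary: u)
  case 0
  then show ?case by (auto simp: awalk_Nil_iff)
next
  case (Suc k)
  then obtain w where w: "(u, w) \<in> parcs G" "(w, v) \<in> parcs G ^^ k"
    by (meson relpow_Suc_D2)
  then obtain p where "awalk w p v" "length p = k"
    using Suc.IH in_arcsD2 by blast
  with w show ?case
    by (intro exI[of _ "(u, w) # p"]) (simp add: awalk_Cons_iff)
qed

lemma awalk_imp_relpow: "awalk u p v \<Longrightarrow> (u, v) \<in> parcs G ^^ length p"
proof (induction p arbitrary: u)
  case (Cons a p)
  then have "(u, snd a) \<in> parcs G" "(snd a, v) \<in> parcs G ^^ length p"
    by (auto simp: awalk_Cons_iff)
  then show ?case
    using relpow_Suc_I2[of u "snd a" "parcs G" v "length p"] by simp
qed (simp add: awalk_Nil_iff)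

lemma awalk_cost_1: "awalk_cost (\<lambda>_. 1) p = real (length p)"
  by (induction p) auto

text \<open>Walks correspond to relational powers, so an infimum of costs becomes a least natural
  number, and the empty infimum is infinity. Breadth-first search and Cayley walks are compared in
  this form.\<close>

lemma gdist_eq_Least:
  assumes "u \<in> pverts G"
  shows "gdist G u v =
    (if \<exists>k. (u, v) \<in> parcs G ^^ k then ereal (real (LEAST k. (u, v) \<in> parcs G ^^ k)) else \<infinity>)"
proof (cases "\<exists>k. (u, v) \<in> parcs G ^^ k")
  case True
  define l where "l = (LEAST k. (u, v) \<in> parcs G ^^ k)"
  have l: "(u, v) \<in> parcs G ^^ l" unfolding l_def using True by (rule LeastI_ex)
  then obtain p where p: "awalk u p v" "length p = l"
    using relpow_imp_awalk assms by blast
  have "gdist G u v = ereal (real l)"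
    unfolding gdist_def \<mu>_def
  proof (rule antisym)
    show "(INF p\<in>{p. awalk u p v}. ereal (awalk_cost (\<lambda>_. 1) p)) \<le> ereal (real l)"
      using p by (intro INF_lower2[of p]) (auto simp: awalk_cost_1)
    show "ereal (real l) \<le> (INF p\<in>{p. awalk u p v}. ereal (awalk_cost (\<lambda>_. 1) p))"
      using awalk_imp_relpow by (intro INF_greatest) (auto simp: awalk_cost_1 l_def intro: Least_le)
  qed
  then show ?thesis using True l_def by simp
next
  case False
  then have "\<not> (u \<rightarrow>\<^sup>*\<^bsub>with_proj G\<^esub> v)"
    using awalk_imp_relpow by (auto simp: reachable_awalk)
  then show ?thesis
    unfolding gdist_def using False shortest_path_inf by simp
qed

lemma bfs_eq:
  "bfs G u k = ({v. (u, v) \<in> parcs G ^^ k \<and> (\<forall>j<k. (u, v) \<notin> parcs G ^^ j)},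
    {v. \<exists>j\<le>k. (u, v) \<in> parcs G ^^ j})"
proof (induction k)
  case (Suc k)
  have 1: "parcs G `` {v. (u, v) \<in> parcs G ^^ k \<and> (\<forall>j<k. (u, v) \<notin> parcs G ^^ j)} -
      {v. \<exists>j\<le>k. (u, v) \<in> parcs G ^^ j} =
      {v. (u, v) \<in> parcs G ^^ Suc k \<and> (\<forall>j<Suc k. (u, v) \<notin> parcs G ^^ j)}" (is "?L = ?R")
  proof
    show "?L \<subseteq> ?R" by (auto simp: less_Suc_eq_le)
    show "?R \<subseteq> ?L"
    proof
      fix v assume v: "v \<in> ?R"
      \<comment> \<open>The last vertex \<open>w\<close> before \<open>v\<close> cannot be reached
        in fewer than \<open>k\<close> steps, or \<open>v\<close> would be reached too early; so
        \<open>w\<close> lies in the frontier.\<close>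
      then obtain w where w: "(u, w) \<in> parcs G ^^ k" "(w, v) \<in> parcs G" by auto
      moreover have "(u, w) \<notin> parcs G ^^ j" if "j < k" for j
      proof
        assume "(u, w) \<in> parcs G ^^ j"
        then have "(u, v) \<in> parcs G ^^ Suc j" using w(2) by auto
        then show False using v that by blast
      qed
      ultimately show "v \<in> ?L" using v by (auto simp: less_Suc_eq_le)
    qed
  qed
  have 2: "{v. \<exists>j\<le>k. (u, v) \<in> parcs G ^^ j} \<union>
      {v. (u, v) \<in> parcs G ^^ Suc k \<and> (\<forall>j<Suc k. (u, v) \<notin> parcs G ^^ j)} =
      {v. \<exists>j\<le>Suc k. (u, v) \<in> parcs G ^^ j}" (is "?L \<union> ?M = ?R")
  proof
    show "?L \<union> ?M \<subseteq> ?R" by (blast intro: le_SucI)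
    show "?R \<subseteq> ?L \<union> ?M" by (auto simp: le_Suc_eq less_Suc_eq_le simp del: relpow.simps)
  qed
  show ?case
    by (simp only: bfs.simps Suc.IH Let_def prod.case 1 2)
qed simp

text \<open>Frontiers are disjoint spheres around \<open>u\<close>, so \<open>v\<close> occurs only
  at its distance. Truncation at \<open>D\<close> never falsifies a finite value; it can only
  replace it by infinity.\<close>

lemma bfs_dist_eq_gdist:
  assumes "u \<in> pverts G"
  shows "bfs_dist G D u v = (if gdist G u v \<le> D \<and> gdist G u v \<noteq> \<infinity> then gdist G u v else \<infinity>)"
proof -
  define l where "l = (LEAST k. (u, v) \<in> parcs G ^^ k)"
  have iff: "v \<in> fst (bfs G u k) \<longleftrightarrow> (\<exists>k. (u, v) \<in> parcs G ^^ k) \<and> k = l" for k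
  proof
    assume "v \<in> fst (bfs G u k)"
    then have "(u, v) \<in> parcs G ^^ k" "\<forall>j<k. (u, v) \<notin> parcs G ^^ j" by (auto simp: bfs_eq)
    moreover from this have "k = l"
      unfolding l_def by (intro Least_equality[symmetric]) (auto simp: not_less[symmetric])
    ultimately show "(\<exists>k. (u, v) \<in> parcs G ^^ k) \<and> k = l" by blast
  next
    assume "(\<exists>k. (u, v) \<in> parcs G ^^ k) \<and> k = l"
    then have "(u, v) \<in> parcs G ^^ k" "\<forall>j<k. (u, v) \<notin> parcs G ^^ j"
      unfolding l_def by (auto intro: LeastI dest: not_less_Least)
    then show "v \<in> fst (bfs G u k)" by (simp add: bfs_eq)
  qed
  show ?thesis
    unfolding bfs_dist_def iff gdist_eq_Least[OF assms] l_def[symmetric]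
    by (auto intro: Least_equality)
qed

lemma gdist_refl: "u \<in> pverts G \<Longrightarrow> gdist G u u = 0"
proof -
  assume u: "u \<in> pverts G"
  have 0: "(u, u) \<in> parcs G ^^ 0" by simp
  then have ex: "\<exists>k. (u, u) \<in> parcs G ^^ k" by blast
  have "(LEAST k. (u, u) \<in> parcs G ^^ k) = 0"
    using 0 by (rule Least_eq_0)
  then show ?thesis
    unfolding gdist_eq_Least[OF u] using ex by (simp add: zero_ereal_def)
qed

lemma gdist_eq_0_imp_eq:
  assumes "u \<in> pverts G" "gdist G u v = 0"
  shows "u = v"
proof -
  have ex: "\<exists>k. (u, v) \<in> parcs G ^^ k" and 0: "(LEAST k. (u, v) \<in> parcs G ^^ k) = 0"
    using assms(2) unfolding gdist_eq_Least[OF assms(1)]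
    by (auto split: if_splits simp: zero_ereal_def)
  from LeastI_ex[OF ex] show ?thesis unfolding 0 by simp
qed

lemma gdist_le_diam: "u \<in> pverts G \<Longrightarrow> v \<in> pverts G \<Longrightarrow> gdist G u v \<le> diam G"
  unfolding diam_def by (meson SUP_upper SUP_upper2)

end

text \<open>Least lengths agree already if walks of \<open>C\<close> can be shortened instead of
  copied. A Cayley walk may contain steps that cancel, so a walk of the same length in
  \<open>G\<close> cannot be expected.\<close>

lemma gdist_eqI:
  assumes "pair_wf_digraph C" "pair_wf_digraph G" "x \<in> pverts C" "u \<in> pverts G"
    and "\<And>k. (x, y) \<in> parcs C ^^ k \<Longrightarrow> \<exists>j\<le>k. (u, v) \<in> parcs G ^^ j"
    and "\<And>k. (u, v) \<in> parcs G ^^ k \<Longrightarrow> (x, y) \<in> parcs C ^^ k"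
  shows "gdist C x y = gdist G u v"
proof -
  have "(LEAST k. (x, y) \<in> parcs C ^^ k) = (LEAST k. (u, v) \<in> parcs G ^^ k)"
    if ex: "\<exists>k. (u, v) \<in> parcs G ^^ k"
  proof (rule Least_equality)
    show "(x, y) \<in> parcs C ^^ (LEAST k. (u, v) \<in> parcs G ^^ k)"
      using LeastI_ex[OF ex] assms(6) by blast
    fix k assume "(x, y) \<in> parcs C ^^ k"
    then obtain j where "j \<le> k" "(u, v) \<in> parcs G ^^ j" using assms(5) by blast
    then show "(LEAST k. (u, v) \<in> parcs G ^^ k) \<le> k" by (meson Least_le le_trans)
  qed
  moreover have "(\<exists>k. (x, y) \<in> parcs C ^^ k) \<longleftrightarrow> (\<exists>k. (u, v) \<in> parcs G ^^ k)"
    using assms(5,6) by blast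
  ultimately show ?thesis
    using assms(1-4) by (simp add: pair_wf_digraph.gdist_eq_Least)
qed

section \<open>Integral cycle bases\<close>

lemma signed_crossings_Nil [simp]: "signed_crossings F [] = 0"
  by (simp add: signed_crossings_def)

lemma signed_crossings_Cons [simp]:
  "signed_crossings F (b # p) =
    (if b \<in> F then 1 else if prod.swap b \<in> F then -1 else 0) + signed_crossings F p"
  by (simp add: signed_crossings_def)

lemma signed_crossings_not_in:
  "a \<notin> set p \<Longrightarrow> prod.swap a \<notin> set p \<Longrightarrow> signed_crossings {a} p = 0"
  by (induction p) auto

lemma signed_crossings_once:
  "distinct p \<Longrightarrow> a \<in> set p \<Longrightarrow> prod.swap a \<notin> set p \<Longrightarrow> signed_crossings {a} p = 1"
proof (induction p)
  case (Cons b p)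
  then show ?case
    by (cases "a = b") (auto simp: signed_crossings_not_in)
qed simp

section \<open>Circulations and simple cycles\<close>

context pair_graph
begin

lemma reachable_if_connected:
  assumes "connected (with_proj G)" "u \<in> pverts G" "v \<in> pverts G"
  shows "u \<rightarrow>\<^sup>*\<^bsub>with_proj G\<^esub> v"
  using assms by (auto simp: connected_def strongly_connected_def reachable_mk_symmetric_eq[OF sym_arcs])

lemma swap_in_parcs_iff: "prod.swap a \<in> parcs G \<longleftrightarrow> a \<in> parcs G"
  by (cases a) (auto intro: arcs_symmetric)

lemma swap_neq: "a \<in> parcs G \<Longrightarrow> prod.swap a \<noteq> a"
  by (cases a) (auto dest: no_loops')

lemma circulation_swap: "circulation G x \<Longrightarrow> x (prod.swap a) = - x a"
  and circulation_outside: "circulation G x \<Longrightarrow> a \<notin> parcs G \<Longrightarrow> x a = 0"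
  by (auto simp only: circulation_def)

lemma circulation_signed_crossings:
  assumes "set p \<subseteq> parcs G" "pcas u p u"
  shows "circulation G (\<lambda>a. signed_crossings {a} p)"
proof -
  have "signed_crossings {a} p = 0" if "a \<notin> parcs G" for a
    using that assms(1) swap_in_parcs_iff by (intro signed_crossings_not_in) blast+
  moreover have "signed_crossings {prod.swap a} p = - signed_crossings {a} p" for a
    using assms(1)
  proof (induction p)
    case (Cons b p)
    then have "prod.swap b \<noteq> b" using swap_neq by auto
    moreover have "b = prod.swap a \<longleftrightarrow> prod.swap b = a" "prod.swap b = prod.swap a \<longleftrightarrow> b = a"
      by (cases a; cases b; auto)+
    ultimately show ?case using Cons by auto
  qed simp
  \<comment> \<open>Stated for walks with arbitrary ends so that induction applies: one unit leaves
    \<open>u\<close> and one arrives at \<open>w\<close>, which cancels on a closed walk.\<close>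
  moreover have "(\<Sum>a | a \<in> parcs G \<and> fst a = v. signed_crossings {a} p) =
      (if v = u then 1 else 0) - (if v = w then 1 else 0)"
    if "set p \<subseteq> parcs G" "pcas u p w" for u v w
    using that
  proof (induction p arbitrary: u)
    case (Cons b p)
    have b: "b \<in> parcs G" "prod.swap b \<in> parcs G" "prod.swap b \<noteq> b" "fst b = u"
      using Cons.prems swap_in_parcs_iff swap_neq by auto
    have fin: "finite {a. a \<in> parcs G \<and> fst a = v}" by simp
    have "(\<Sum>a | a \<in> parcs G \<and> fst a = v. if b \<in> {a} then 1 else if prod.swap b \<in> {a} then -1 else (0::int)) =
      (\<Sum>a | a \<in> parcs G \<and> fst a = v. (if a = b then 1 else 0) - (if a = prod.swap b then 1 else 0))"
      using b by (intro sum.cong) auto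
    also have "\<dots> = (if v = fst b then 1 else 0) - (if v = snd b then 1 else 0)"
      using b fin by (auto simp: sum_subtractf)
    finally show ?case
      using Cons b by (simp add: sum.distrib)
  qed simp
  ultimately show ?thesis
    unfolding circulation_def using assms by (intro conjI allI impI ballI) simp_all
qed

text \<open>The reverse of \<open>a\<close> leaves the head of \<open>a\<close> with a negative
  value, and conservation at that vertex demands a positive value to balance it.\<close>

lemma positive_out_dart:
  assumes "circulation G x" "a \<in> parcs G" "0 < x a"
  shows "\<exists>b\<in>parcs G. 0 < x b \<and> fst b = snd a"
proof (rule ccontr)
  assume *: "\<not> ?thesis"
  have "(\<Sum>b | b \<in> parcs G \<and> fst b = snd a. x b) < (\<Sum>b | b \<in> parcs G \<and> fst b = snd a. 0)"
  proof (rule sum_strict_mono_ex1)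
    show "\<forall>b\<in>{b. b \<in> parcs G \<and> fst b = snd a}. x b \<le> 0" using * by force
    show "\<exists>b\<in>{b. b \<in> parcs G \<and> fst b = snd a}. x b < 0"
      using assms(2,3) swap_in_parcs_iff[of a] circulation_swap[OF assms(1), of a]
      by (intro bexI[of _ "prod.swap a"]) auto
  qed simp
  moreover have "snd a \<in> pverts G" using assms(2) by (simp add: arc_snd_in_verts)
  then have "(\<Sum>b | b \<in> parcs G \<and> fst b = snd a. x b) = 0"
    using assms(1) unfolding circulation_def by blast
  ultimately show False by simp
qed

text \<open>Every positive dart is followed by another one, and in a finite graph such a sequence
  revisits a vertex; a shortest return is a simple cycle. Positivity of its darts is recorded
  because it prevents the cycle from using an edge in both directions.\<close>

lemma positive_cycle:
  assumes "circulation G x" "x a \<noteq> 0"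
  shows "\<exists>p. cycle p \<and> (\<forall>b\<in>set p. 0 < x b)"
proof -
  have "a \<in> parcs G" using assms circulation_outside by blast
  have "\<exists>a\<in>parcs G. 0 < x a"
  proof (cases "0 < x a")
    case False
    then have "0 < x (prod.swap a)" using assms(2) circulation_swap[OF assms(1), of a] by simp
    then show ?thesis using \<open>a \<in> parcs G\<close> swap_in_parcs_iff by blast
  qed (use \<open>a \<in> parcs G\<close> in blast)
  then obtain a0 where a0: "a0 \<in> parcs G" "0 < x a0" by blast
  define nxt :: "'a \<times> 'a \<Rightarrow> 'a \<times> 'a" where "nxt a = (SOME b. b \<in> parcs G \<and> 0 < x b \<and> fst b = snd a)" for a
  have nxt: "nxt a \<in> parcs G \<and> 0 < x (nxt a) \<and> fst (nxt a) = snd a" if "a \<in> parcs G" "0 < x a" for a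
    unfolding nxt_def by (rule someI_ex) (use positive_out_dart[OF assms(1) that] in blast)
  define f where "f i = (nxt ^^ i) a0" for i
  have f: "f i \<in> parcs G \<and> 0 < x (f i)" for i
    unfolding f_def by (induction i) (use a0 nxt in auto)
  have f_next: "fst (f (Suc i)) = snd (f i)" for i
    using nxt[of "f i"] f[of i] unfolding f_def by simp
  have "\<not> inj (\<lambda>i. fst (f i))"
  proof
    assume "inj (\<lambda>i. fst (f i))"
    moreover have "finite (range (\<lambda>i. fst (f i)))"
      by (rule finite_subset[OF _ pair_finite_verts]) (use f arc_fst_in_verts in auto)
    ultimately show False using finite_imageD infinite_UNIV_nat by blast
  qed
  then obtain i j where "i < j" "fst (f i) = fst (f j)"
    by (metis injI linorder_neqE_nat)
  then have ex: "\<exists>n. 0 < n \<and> (\<exists>i. fst (f i) = fst (f (i + n)))"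
    by (intro exI[of _ "j - i"] conjI exI[of _ i]) auto
  \<comment> \<open>The least gap over all starting points, so a repetition strictly inside the
    segment would be a smaller gap.\<close>
  define n where "n = (LEAST n. 0 < n \<and> (\<exists>i. fst (f i) = fst (f (i + n))))"
  have "0 < n" "\<exists>i. fst (f i) = fst (f (i + n))"
    using LeastI_ex[OF ex] unfolding n_def by auto
  then obtain i where i: "fst (f i) = fst (f (i + n))" by blast
  have min: "fst (f k) \<noteq> fst (f (k + m))" if "0 < m" "m < n" for k m
    using not_less_Least[of m "\<lambda>n. 0 < n \<and> (\<exists>i. fst (f i) = fst (f (i + n)))"] that
    unfolding n_def by blast
  define p where "p = map f [i..<i+n]"
  have walk: "awalk (fst (f k)) (map f [k..<k+m]) (fst (f (k+m)))" for k m
  proof (induction m arbitrary: k)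
    case 0
    then show ?case using f arc_fst_in_verts by (auto simp: awalk_Nil_iff)
  next
    case (Suc m)
    have "[k..<k + Suc m] = k # [Suc k..<Suc k + m]" by (simp add: upt_conv_Cons)
    then show ?case using Suc[of "Suc k"] f[of k] f_next[of k] by (simp add: awalk_Cons_iff)
  qed
  have "awalk (fst (f i)) p (fst (f i))" unfolding p_def using walk[of i n] i by simp
  moreover have "p \<noteq> []" using \<open>0 < n\<close> by (simp add: p_def)
  moreover have "distinct (tl (pawalk_verts (fst (f i)) p))"
  proof -
    have "pawalk_verts u q = u # map snd q" if "pcas u q w" for u q w
      using that by (induction q arbitrary: u) auto
    moreover have "pcas (fst (f i)) p (fst (f i))"
      using \<open>awalk (fst (f i)) p (fst (f i))\<close> by (simp add: awalk_def)
    ultimately have "tl (pawalk_verts (fst (f i)) p) = map snd p"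
      by (metis list.sel(3))
    then have "tl (pawalk_verts (fst (f i)) p) = map (\<lambda>j. fst (f (Suc j))) [i..<i+n]"
      by (simp add: p_def f_next)
    moreover have "fst (f (Suc j)) \<noteq> fst (f (Suc k))" if "j < k" "k < i + n" "i \<le> j" for j k
      using min[of "k - j" "Suc j"] that by simp
    then have "inj_on (\<lambda>j. fst (f (Suc j))) {i..<i+n}"
      by (intro linorder_inj_onI') auto
    ultimately show ?thesis by (simp add: distinct_map)
  qed
  ultimately have "cycle p" unfolding cycle_def by blast
  moreover have "\<forall>b\<in>set p. 0 < x b" using f by (auto simp: p_def)
  ultimately show ?thesis by blast
qed

lemma circulation_diff_scale:
  assumes "circulation G x" "circulation G z"
  shows "circulation G (\<lambda>a. x a - c * z a)"
  unfolding circulation_def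
proof (intro conjI allI impI ballI)
  fix a
  show "x a - c * z a = 0" if "a \<notin> parcs G"
    using that assms by (simp add: circulation_outside)
  show "x (prod.swap a) - c * z (prod.swap a) = - (x a - c * z a)"
    by (simp only: circulation_swap[OF assms(1)] circulation_swap[OF assms(2)])
next
  fix v assume "v \<in> pverts G"
  then show "(\<Sum>a | a \<in> parcs G \<and> fst a = v. x a - c * z a) = 0"
    using assms unfolding circulation_def by (simp add: sum_subtractf flip: sum_distrib_left)
qed

text \<open>A cycle \<open>C\<close> inside \<open>A\<close> provides a pivot edge that it crosses
  exactly once. The coefficient 1 allows elimination over the integers: subtracting a multiple of
  \<open>C\<close> clears the pivot, and what remains lives on a smaller set of darts. The other
  basis cycles avoid the pivot, so spanning and independence are both triangular.\<close>

lemma ex_cycle_basis_on: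
  assumes "finite A"
  shows "\<exists>Bs. (\<forall>B\<in>set Bs. cycle B \<and> set B \<subseteq> A) \<and>
    (\<forall>x. circulation G x \<and> (\<forall>a. a \<notin> A \<longrightarrow> x a = 0) \<longrightarrow>
      (\<exists>y. \<forall>a. x a = (\<Sum>i<length Bs. y i * signed_crossings {a} (Bs ! i)))) \<and>
    (\<forall>y y'. (\<forall>a. (\<Sum>i<length Bs. y i * signed_crossings {a} (Bs ! i)) =
        (\<Sum>i<length Bs. y' i * signed_crossings {a} (Bs ! i))) \<longrightarrow> (\<forall>i<length Bs. y i = y' i))"
  using assms
proof (induction A rule: finite_psubset_induct)
  case (psubset A)
  show ?case
  proof (cases "\<exists>x a. circulation G x \<and> (\<forall>a. a \<notin> A \<longrightarrow> x a = 0) \<and> x a \<noteq> 0")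
    case False
    then show ?thesis by (intro exI[of _ "[]"]) auto
  next
    case True
    then obtain x a where x: "circulation G x" "\<forall>a. a \<notin> A \<longrightarrow> x a = 0" "x a \<noteq> 0" by blast
    then obtain C where C: "cycle C" "\<forall>b\<in>set C. 0 < x b" using positive_cycle by blast
    then have C_A: "set C \<subseteq> A" using x(2) by force
    obtain a0 C' where a0: "C = a0 # C'" using C(1) by (cases C) (auto simp: cycle_def)
    \<comment> \<open>Values at reverse darts have opposite signs. In particular \<open>C\<close> is
      not a two-dart closed walk.\<close>
    have swap_C: "prod.swap b \<notin> set C" if "b \<in> set C" for b
      proof
      assume "prod.swap b \<in> set C"
      then have "0 < x (prod.swap b)" "0 < x b" using that C(2) by blast+
      then show False using circulation_swap[OF x(1), of b] by simp
    qed
    have dist: "distinct C" using C(1) by (auto simp: cycle_conv)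
    have C_a0: "signed_crossings {a0} C = 1"
      using signed_crossings_once[OF dist] swap_C a0 by (metis list.set_intros(1))
    have circ_C: "circulation G (\<lambda>a. signed_crossings {a} C)"
      using C(1) by (auto simp: cycle_def awalk_def intro: circulation_signed_crossings)
    define A' where "A' = A - {a0, prod.swap a0}"
    have "A' \<subset> A" using C_A a0 unfolding A'_def by auto
    from psubset.IH[OF this] obtain Bs where Bs: "\<forall>B\<in>set Bs. cycle B \<and> set B \<subseteq> A'"
      and span0: "\<forall>x. circulation G x \<and> (\<forall>a. a \<notin> A' \<longrightarrow> x a = 0) \<longrightarrow>
        (\<exists>y. \<forall>a. x a = (\<Sum>i<length Bs. y i * signed_crossings {a} (Bs ! i)))"
      and indep0: "\<forall>y y'. (\<forall>a. (\<Sum>i<length Bs. y i * signed_crossings {a} (Bs ! i)) =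
        (\<Sum>i<length Bs. y' i * signed_crossings {a} (Bs ! i))) \<longrightarrow> (\<forall>i<length Bs. y i = y' i)"
      by (elim exE conjE)
    have span: "\<exists>y. \<forall>a. x a = (\<Sum>i<length Bs. y i * signed_crossings {a} (Bs ! i))"
      if "circulation G x" "\<And>a. a \<notin> A' \<Longrightarrow> x a = 0" for x
      using span0 that by blast
    have indep: "y i = y' i"
      if "\<And>a. (\<Sum>i<length Bs. y i * signed_crossings {a} (Bs ! i)) =
        (\<Sum>i<length Bs. y' i * signed_crossings {a} (Bs ! i))" "i < length Bs" for y y' i
      using indep0 that by blast
    have sum_Cons: "(\<Sum>i<length (C # Bs). y i * signed_crossings {a} ((C # Bs) ! i)) =
        y 0 * signed_crossings {a} C + (\<Sum>i<length Bs. y (Suc i) * signed_crossings {a} (Bs ! i))"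
      for y :: "nat \<Rightarrow> int" and a
      by (simp only: list.size(4) add_Suc_right add_0_right sum.lessThan_Suc_shift
        nth_Cons_0 nth_Cons_Suc Nat.One_nat_def)
    have Bs_a0: "(\<Sum>i<length Bs. y i * signed_crossings {a0} (Bs ! i)) = 0" for y :: "nat \<Rightarrow> int"
    proof (rule sum.neutral, intro ballI)
      fix i assume "i \<in> {..<length Bs}"
      then have "set (Bs ! i) \<subseteq> A'" using Bs by simp
      then have "a0 \<notin> set (Bs ! i)" "prod.swap a0 \<notin> set (Bs ! i)" unfolding A'_def by auto
      then show "y i * signed_crossings {a0} (Bs ! i) = 0" by (simp add: signed_crossings_not_in)
    qed
    show ?thesis
    proof (intro exI[of _ "C # Bs"] conjI)
      show "\<forall>B\<in>set (C # Bs). cycle B \<and> set B \<subseteq> A"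
        using Bs C(1) C_A unfolding A'_def by auto
      show "\<forall>z. circulation G z \<and> (\<forall>a. a \<notin> A \<longrightarrow> z a = 0) \<longrightarrow>
        (\<exists>y. \<forall>a. z a = (\<Sum>i<length (C # Bs). y i * signed_crossings {a} ((C # Bs) ! i)))"
      proof (intro allI impI)
        fix z assume z: "circulation G z \<and> (\<forall>a. a \<notin> A \<longrightarrow> z a = 0)"
        define z' where "z' a = z a - z a0 * signed_crossings {a} C" for a
        have circ: "circulation G z'"
          unfolding z'_def using z circ_C circulation_diff_scale by blast
        have "z' a = 0" if "a \<notin> A'" for a
        proof -
          have "z' a0 = 0" unfolding z'_def by (simp add: C_a0)
          then have "z' (prod.swap a0) = 0" using circulation_swap[OF circ, of a0] by simp
          moreover have "z' a = 0" if "a \<notin> A"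
          proof -
            \<comment> \<open>\<open>A\<close> need not be closed under reversal, but antisymmetry
              makes \<open>x\<close> vanish at both darts of this edge.\<close>
            have "a \<notin> set C" "prod.swap a \<notin> set C"
              using that C(2) x(2) circulation_swap[OF x(1), of a]
              by (metis less_irrefl, metis less_irrefl neg_0_equal_iff_equal)
            moreover have "z a = 0" using that z by blast
            ultimately show ?thesis by (simp add: z'_def signed_crossings_not_in)
          qed
          ultimately show ?thesis
            using that \<open>z' a0 = 0\<close> unfolding A'_def by blast
        qed
        then obtain y where y: "\<forall>a. z' a = (\<Sum>i<length Bs. y i * signed_crossings {a} (Bs ! i))"
          using span[OF circ] by blast
        define y' where "y' i = (case i of 0 \<Rightarrow> z a0 | Suc j \<Rightarrow> y j)" for i
        have "z a = (\<Sum>i<length (C # Bs). y' i * signed_crossings {a} ((C # Bs) ! i))" for a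
          unfolding sum_Cons using y[rule_format, of a] by (simp add: y'_def z'_def)
        then show "\<exists>y. \<forall>a. z a = (\<Sum>i<length (C # Bs). y i * signed_crossings {a} ((C # Bs) ! i))"
          by blast
      qed
      show "\<forall>y y'. (\<forall>a. (\<Sum>i<length (C # Bs). y i * signed_crossings {a} ((C # Bs) ! i)) =
          (\<Sum>i<length (C # Bs). y' i * signed_crossings {a} ((C # Bs) ! i))) \<longrightarrow>
          (\<forall>i<length (C # Bs). y i = y' i)"
      proof (intro allI impI)
        fix y y' :: "nat \<Rightarrow> int" and i
        assume eq: "\<forall>a. (\<Sum>i<length (C # Bs). y i * signed_crossings {a} ((C # Bs) ! i)) =
          (\<Sum>i<length (C # Bs). y' i * signed_crossings {a} ((C # Bs) ! i))"
          and i: "i < length (C # Bs)"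
        have 0: "y 0 = y' 0"
          using eq[unfolded sum_Cons, rule_format, of a0] by (simp add: C_a0 Bs_a0)
        then have "(\<Sum>i<length Bs. y (Suc i) * signed_crossings {a} (Bs ! i)) =
            (\<Sum>i<length Bs. y' (Suc i) * signed_crossings {a} (Bs ! i))" for a
          using eq[unfolded sum_Cons, rule_format, of a] by simp
        then have "y (Suc j) = y' (Suc j)" if "j < length Bs" for j
          by (rule indep[of "\<lambda>i. y (Suc i)" "\<lambda>i. y' (Suc i)", OF _ that])
        with 0 i show "y i = y' i" by (cases i) auto
      qed
    qed
  qed
qed

lemma ex_integral_cycle_basis: "\<exists>Bs. integral_cycle_basis G Bs"
proof -
  obtain Bs where Bs: "\<forall>B\<in>set Bs. cycle B \<and> set B \<subseteq> parcs G"
    and span0: "\<forall>x. circulation G x \<and> (\<forall>a. a \<notin> parcs G \<longrightarrow> x a = 0) \<longrightarrow>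
      (\<exists>y. \<forall>a. x a = (\<Sum>i<length Bs. y i * signed_crossings {a} (Bs ! i)))"
    and indep0: "\<forall>y y'. (\<forall>a. (\<Sum>i<length Bs. y i * signed_crossings {a} (Bs ! i)) =
      (\<Sum>i<length Bs. y' i * signed_crossings {a} (Bs ! i))) \<longrightarrow> (\<forall>i<length Bs. y i = y' i)"
    using ex_cycle_basis_on[OF pair_finite_arcs] by (elim exE conjE)
  have span: "\<exists>y. \<forall>a. x a = (\<Sum>i<length Bs. y i * signed_crossings {a} (Bs ! i))"
    if "circulation G x" "\<And>a. a \<notin> parcs G \<Longrightarrow> x a = 0" for x
    using span0 that by blast
  have indep: "y i = y' i"
    if "\<And>a. (\<Sum>i<length Bs. y i * signed_crossings {a} (Bs ! i)) =
      (\<Sum>i<length Bs. y' i * signed_crossings {a} (Bs ! i))" "i < length Bs" for y y' i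
    using indep0 that by blast
  have "\<exists>!y. y \<in> carrier (Zpow (length Bs)) \<and>
      (\<forall>a. x a = (\<Sum>i<length Bs. y i * signed_crossings {a} (Bs ! i)))" if x: "circulation G x" for x
  proof -
    obtain y where y: "\<forall>a. x a = (\<Sum>i<length Bs. y i * signed_crossings {a} (Bs ! i))"
      using span[OF x circulation_outside[OF x]] by blast
    show ?thesis
    proof (rule ex1I[of _ "restrict y {..<length Bs}"])
      show "restrict y {..<length Bs} \<in> carrier (Zpow (length Bs)) \<and>
        (\<forall>a. x a = (\<Sum>i<length Bs. restrict y {..<length Bs} i * signed_crossings {a} (Bs ! i)))"
        using y by (simp add: carrier_Zpow)
      fix y' assume y': "y' \<in> carrier (Zpow (length Bs)) \<and>
        (\<forall>a. x a = (\<Sum>i<length Bs. y' i * signed_crossings {a} (Bs ! i)))"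
      then have "(\<Sum>i<length Bs. y' i * signed_crossings {a} (Bs ! i)) =
          (\<Sum>i<length Bs. y i * signed_crossings {a} (Bs ! i))" for a
        using y by metis
      then have "y' i = y i" if "i < length Bs" for i
        by (rule indep[OF _ that])
      then show "y' = restrict y {..<length Bs}"
        using y' by (intro extensionalityI[of _ "{..<length Bs}"]) (auto simp: carrier_Zpow)
    qed
  qed
  then show ?thesis
    unfolding integral_cycle_basis_def using Bs by blast
qed

end

section \<open>Universal groups and folds\<close>

lemma int_pow_product_group:
  assumes "x \<in> carrier (product_group I F)" "\<And>i. i \<in> I \<Longrightarrow> group (F i)" "i \<in> I"
  shows "(x [^]\<^bsub>product_group I F\<^esub> (m::int)) i = x i [^]\<^bsub>F i\<^esub> m"
proof -
  interpret group "product_group I F" using assms(2) by (rule product_group)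
  have pow: "(x [^]\<^bsub>product_group I F\<^esub> n) i = x i [^]\<^bsub>F i\<^esub> n" for n :: nat
    using assms(3) by (rule nat_pow_product_group)
  have "x [^]\<^bsub>product_group I F\<^esub> n \<in> (\<Pi>\<^sub>E i\<in>I. carrier (F i))" for n :: nat
    using nat_pow_closed[OF assms(1)] by simp
  from inv_product_group[OF this assms(2)]
  have "(inv\<^bsub>product_group I F\<^esub> (x [^]\<^bsub>product_group I F\<^esub> n)) i = inv\<^bsub>F i\<^esub> (x i [^]\<^bsub>F i\<^esub> n)"
    for n :: nat
    using assms(3) by (simp only: restrict_apply' pow)
  then show ?thesis
    by (simp only: int_pow_def2 pow if_distrib[of "\<lambda>f. f i"] if_distribR split: if_split)
qed

text \<open>Applied with \<open>n = 0\<close> to \<open>Zpow\<close> and with \<open>n = 2\<close>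
  to \<open>F2E\<close>; modulo 1 the entry 1 would not be a residue. The induction clears the
  support of \<open>x\<close> one coordinate at a time.\<close>

lemma generate_product_units:
  fixes n :: nat and I :: "'i set"
  defines "u \<equiv> \<lambda>i. \<lambda>j\<in>I. if j = i then 1 else 0"
  assumes "finite I" "n \<noteq> 1"
  shows "u ` I \<subseteq> carrier (product_group I (\<lambda>_. integer_mod_group n))"
    and "generate (product_group I (\<lambda>_. integer_mod_group n)) (u ` I) =
      carrier (product_group I (\<lambda>_. integer_mod_group n))"
proof -
  let ?C = "product_group I (\<lambda>_. integer_mod_group n)"
  interpret group ?C by simp
  show sub: "u ` I \<subseteq> carrier ?C"
    using assms(3) by (auto simp: u_def)
  have step: "J \<subseteq> I \<Longrightarrow> x \<in> carrier ?C \<Longrightarrow> (\<And>j. j \<in> I - J \<Longrightarrow> x j = 0) \<Longrightarrow> x \<in> generate ?C (u ` I)"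
    if "finite J" for J x
    using that
  proof (induction J arbitrary: x)
    case empty
    then have "x = \<one>\<^bsub>?C\<^esub>" by (intro PiE_ext[of x I _ _]) auto
    then show ?case using generate.one by metis
  next
    case (insert i J)
    define x' where "x' = (\<lambda>j\<in>I. if j = i then 0 else x j)"
    have i: "i \<in> I" using insert.prems by auto
    have xj: "x j \<in> carrier (integer_mod_group n)" if "j \<in> I" for j
      using insert.prems(2) that by auto
    have xj_mod: "x j mod int n = x j" if "j \<in> I" for j
      using xj[OF that] by (auto simp: carrier_integer_mod_group split: if_splits)
    have x': "x' \<in> carrier ?C" using xj by (auto simp: x'_def)
    have "x' \<in> generate ?C (u ` I)"
      using insert.prems x' by (intro insert.IH) (auto simp: x'_def)
    moreover have "u i [^]\<^bsub>?C\<^esub> x i \<in> generate ?C (u ` I)"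
      using i by (intro subgroup_int_pow_closed generate_is_subgroup sub generate.incl) auto
    ultimately have "u i [^]\<^bsub>?C\<^esub> x i \<otimes>\<^bsub>?C\<^esub> x' \<in> generate ?C (u ` I)"
      by (rule generate.eng[rotated])
    moreover have "u i [^]\<^bsub>?C\<^esub> x i \<otimes>\<^bsub>?C\<^esub> x' = x"
    proof (rule PiE_ext)
      show "x \<in> (\<Pi>\<^sub>E i\<in>I. carrier (integer_mod_group n))" using insert.prems(2) by simp
      have ui: "u i \<in> carrier ?C" using sub i by blast
      then have "u i [^]\<^bsub>?C\<^esub> x i \<otimes>\<^bsub>?C\<^esub> x' \<in> carrier ?C"
        using x' by (intro m_closed int_pow_closed)
      then show "u i [^]\<^bsub>?C\<^esub> x i \<otimes>\<^bsub>?C\<^esub> x' \<in> (\<Pi>\<^sub>E i\<in>I. carrier (integer_mod_group n))"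
        by simp
      fix j assume j: "j \<in> I"
      have "(u i [^]\<^bsub>?C\<^esub> x i) j = (x i * u i j) mod int n"
        using int_pow_product_group[OF ui _ j] by (simp add: int_pow_integer_mod_group)
      then show "(u i [^]\<^bsub>?C\<^esub> x i \<otimes>\<^bsub>?C\<^esub> x') j = x j"
        using j xj_mod[OF j] by (cases "j = i") (simp_all add: x'_def u_def)
    qed
    ultimately show ?case by simp
  qed
  show "generate ?C (u ` I) = carrier ?C"
  proof
    show "generate ?C (u ` I) \<subseteq> carrier ?C" using sub by (rule generate_incl)
    show "carrier ?C \<subseteq> generate ?C (u ` I)"
      using step[OF assms(2)] by blast
  qed
qed

lemma (in comm_group) generate_FactGroup:
  assumes "subgroup N G" "X \<subseteq> carrier G" "generate G X = carrier G"
  shows "(\<lambda>x. N #> x) ` X \<subseteq> carrier (G Mod N)"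
    and "generate (G Mod N) ((\<lambda>x. N #> x) ` X) = carrier (G Mod N)"
proof -
  interpret normal N G using assms(1) by (rule subgroup_imp_normal)
  interpret group_hom G "G Mod N" "\<lambda>x. N #> x"
    using r_coset_hom_Mod factorgroup_is_group is_group
    by (simp add: group_hom_def group_hom_axioms_def)
  show "(\<lambda>x. N #> x) ` X \<subseteq> carrier (G Mod N)"
    using assms(2) by auto
  show "generate (G Mod N) ((\<lambda>x. N #> x) ` X) = carrier (G Mod N)"
    using generate_img[OF assms(2)] assms(3) by (simp add: carrier_FactGroup)
qed

lemma generate_iso:
  assumes "group Q" "group H" "\<psi> \<in> iso Q H" "X \<subseteq> carrier Q" "generate Q X = carrier Q"
  shows "\<psi> ` X \<subseteq> carrier H" and "generate H (\<psi> ` X) = carrier H"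
proof -
  interpret group_hom Q H \<psi>
    using assms(1-3) by (simp add: group_hom_def group_hom_axioms_def iso_imp_homomorphism)
  show "\<psi> ` X \<subseteq> carrier H" using assms(4) by auto
  show "generate H (\<psi> ` X) = carrier H"
    using generate_img[OF assms(4)] assms(3,5) by (simp add: Group.iso_iff)
qed

lemma subgroup_row_lattice: "subgroup (row_lattice A) (Zpow (dim_col A))"
proof -
  interpret R: comm_group "Zpow (dim_row A)" by (rule comm_group_Zpow)
  interpret C: comm_group "Zpow (dim_col A)" by (rule comm_group_Zpow)
  let ?h = "\<lambda>y. \<lambda>j\<in>{..<dim_col A}. \<Sum>i<dim_row A. y i * A $$ (i, j)"
  have "?h \<in> hom (Zpow (dim_row A)) (Zpow (dim_col A))"
  proof (rule homI)
    show "?h y \<in> carrier (Zpow (dim_col A))" for y by (simp add: carrier_Zpow)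
    fix y y'
    have "(\<Sum>i<dim_row A. (y \<otimes>\<^bsub>Zpow (dim_row A)\<^esub> y') i * A $$ (i, j)) =
        (\<Sum>i<dim_row A. y i * A $$ (i, j)) + (\<Sum>i<dim_row A. y' i * A $$ (i, j))" for j
      by (simp add: Zpow_def distrib_right sum.distrib)
    then show "?h (y \<otimes>\<^bsub>Zpow (dim_row A)\<^esub> y') = ?h y \<otimes>\<^bsub>Zpow (dim_col A)\<^esub> ?h y'"
      by (simp add: Zpow_def cong: restrict_cong)
  qed
  then interpret group_hom "Zpow (dim_row A)" "Zpow (dim_col A)" ?h
    by unfold_locales
  show ?thesis unfolding row_lattice_def by (rule img_is_subgroup)
qed

lemma comm_group_univ_group: "comm_group (univ_group A)"
  unfolding univ_group_def
  by (rule comm_group.abelian_FactGroup[OF comm_group_Zpow subgroup_row_lattice])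

lemma generate_class_gens:
  shows "class_gen A ` {..<dim_col A} \<subseteq> carrier (univ_group A)"
    and "generate (univ_group A) (class_gen A ` {..<dim_col A}) = carrier (univ_group A)"
proof -
  interpret comm_group "Zpow (dim_col A)" by (rule comm_group_Zpow)
  define u :: "nat \<Rightarrow> nat \<Rightarrow> int"
    where "u = (\<lambda>i. \<lambda>j\<in>{..<dim_col A}. if j = i then 1 else 0)"
  have Z: "Zpow (dim_col A) = product_group {..<dim_col A} (\<lambda>_. integer_mod_group 0)"
    by (simp add: Zpow_def integer_group_eq_mod_0)
  have u: "u ` {..<dim_col A} \<subseteq> carrier (Zpow (dim_col A))"
      "generate (Zpow (dim_col A)) (u ` {..<dim_col A}) = carrier (Zpow (dim_col A))"
    unfolding Z u_def by (rule generate_product_units; simp)+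
  have "class_gen A ` {..<dim_col A} =
      (\<lambda>x. row_lattice A #>\<^bsub>Zpow (dim_col A)\<^esub> x) ` u ` {..<dim_col A}"
    by (simp add: image_image class_gen_def u_def)
  then show "class_gen A ` {..<dim_col A} \<subseteq> carrier (univ_group A)"
      "generate (univ_group A) (class_gen A ` {..<dim_col A}) = carrier (univ_group A)"
    unfolding univ_group_def using generate_FactGroup[OF subgroup_row_lattice u] by simp_all
qed

lemma (in pair_graph) ex_path_labels:
  assumes "connected (with_proj G)"
  shows "\<exists>l. path_labels G \<Gamma> \<gamma> l"
proof -
  obtain r where r: "r \<in> pverts G"
    using assms by (auto simp: connected_def strongly_connected_def)
  have "\<forall>v\<in>pverts G. \<exists>p. apath r p v"
    using reachable_if_connected[OF assms r] by (simp add: reachable_apath)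
  then obtain p where "\<forall>v\<in>pverts G. apath r (p v) v" by metis
  then show ?thesis
    unfolding path_labels_def using r
    by (intro exI[of _ "\<lambda>v. path_sum \<Gamma> \<gamma> (p v)"] bexI[of _ r]) auto
qed

lemma (in pair_graph) path_labels_closed:
  assumes "group \<Gamma>" "\<And>a. a \<in> parcs G \<Longrightarrow> \<gamma> a \<in> carrier \<Gamma>" "path_labels G \<Gamma> \<gamma> l" "v \<in> pverts G"
  shows "l v \<in> carrier \<Gamma>"
proof -
  interpret \<Gamma>: group \<Gamma> by fact
  obtain r p where "apath r p v" "l v = path_sum \<Gamma> \<gamma> p"
    using assms(3,4) unfolding path_labels_def by blast
  moreover have "path_sum \<Gamma> \<gamma> p \<in> carrier \<Gamma>" if "set p \<subseteq> parcs G" for p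
    using that by (induction p) (auto simp: path_sum_def assms(2))
  ultimately show ?thesis by (auto simp: apath_def awalk_def)
qed

lemma oriented_partition_class_unique:
  assumes "oriented_partition G P" "i < length P" "j < length P" "a \<in> P ! i" "a \<in> P ! j"
  shows "i = j"
proof -
  have "P ! i = P ! j"
    using assms unfolding oriented_partition_def partition_on_def
    by (meson disjnt_iff nth_mem pairwiseD)
  then show ?thesis using assms by (simp add: oriented_partition_def nth_eq_iff_index_eq)
qed

text \<open>An oriented partition contains exactly one of the two darts of an edge, in exactly one
  class, so the definite description inside \<open>dart_gen\<close> denotes that class.\<close>

lemma (in pair_graph) dart_gen_closed:
  assumes P: "oriented_partition G P" and "dim_col A = length P" and a: "a \<in> parcs G"
  shows "dart_gen A P a \<in> carrier (univ_group A)"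
proof -
  interpret U: comm_group "univ_group A" by (rule comm_group_univ_group)
  have one: "a \<in> \<Union>(set P) \<longleftrightarrow> prod.swap a \<notin> \<Union>(set P)"
    using P a unfolding oriented_partition_def by blast
  obtain j where j: "j < length P" "a \<in> P ! j \<or> prod.swap a \<in> P ! j"
    using one by (metis UnionE in_set_conv_nth)
  have "(THE j. j < length P \<and> (a \<in> P ! j \<or> prod.swap a \<in> P ! j)) = j"
  proof (rule the_equality)
    fix i assume "i < length P \<and> (a \<in> P ! i \<or> prod.swap a \<in> P ! i)"
    moreover have "\<not> (a \<in> P ! i \<and> prod.swap a \<in> P ! j)" "\<not> (a \<in> P ! j \<and> prod.swap a \<in> P ! i)"
      if "i < length P"
      using one j(1) that by (meson UnionI nth_mem)+
    ultimately show "i = j"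
      using oriented_partition_class_unique[OF P _ j(1)] j(2) by blast
  qed (use j in blast)
  moreover have "class_gen A j \<in> carrier (univ_group A)"
    using generate_class_gens(1)[of A] j(1) assms(2) by auto
  ultimately show ?thesis by (simp add: dart_gen_def)
qed

lemma (in pair_graph) ex_universal:
  assumes "connected (with_proj G)"
  shows "\<exists>U. universal G P U"
proof -
  obtain Bs where Bs: "integral_cycle_basis G Bs" using ex_integral_cycle_basis by blast
  define A where "A = cycle_class_matrix Bs P"
  obtain ts f \<theta> where iso: "0 \<notin> set ts" "sorted_wrt (dvd) ts"
      "\<theta> \<in> iso (univ_group A) (cyclic_product ts \<times>\<times> Zpow f)"
    using comm_group.ex_iso_torsion_free_split[OF comm_group_univ_group _ generate_class_gens[of A]]
    by blast
  obtain l where l: "path_labels G (univ_group A) (dart_gen A P) l"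
    using ex_path_labels[OF assms] by blast
  show ?thesis
    unfolding universal_def Let_def
    by (rule exI[of _ "\<lparr>torsion = ts, free_rank = f, gens = map (\<theta> \<circ> class_gen A) [0..<length P],
        labels = \<theta> \<circ> l\<rparr>"]) (use iso l Bs in \<open>auto simp: A_def split_group_def\<close>)
qed

lemma comm_group_split_group: "comm_group (split_group U)"
proof -
  interpret T: comm_group "cyclic_product (torsion U)" by (rule comm_group_cyclic_product)
  interpret Z: comm_group "Zpow (free_rank U)" by (rule comm_group_Zpow)
  show ?thesis
    unfolding split_group_def
    by (rule group.group_comm_groupI[OF DirProd_group[OF T.is_group Z.is_group]])
      (auto simp: DirProd_def T.m_comm Z.m_comm)
qed

text \<open>All that the treatment of folds retains of \<open>universal\<close>; the cycle basis,
  the isomorphism and the paths are forgotten from here on.\<close>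

lemma (in pair_graph)
  assumes "universal G P U" "oriented_partition G P"
  shows gens_closed: "set (gens U) \<subseteq> carrier (split_group U)"
    and generate_gens: "generate (split_group U) (set (gens U)) = carrier (split_group U)"
    and labels_closed: "labels U ` pverts G \<subseteq> carrier (split_group U)"
    and torsion_nonzero: "0 \<notin> set (torsion U)"
proof -
  obtain Bs \<theta> l where U: "0 \<notin> set (torsion U)" "integral_cycle_basis G Bs"
      "\<theta> \<in> iso (univ_group (cycle_class_matrix Bs P)) (split_group U)"
      "gens U = map (\<theta> \<circ> class_gen (cycle_class_matrix Bs P)) [0..<length P]"
      "path_labels G (univ_group (cycle_class_matrix Bs P)) (dart_gen (cycle_class_matrix Bs P) P) l"
      "labels U = \<theta> \<circ> l"
    using assms(1) unfolding universal_def Let_def by blast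
  define A where "A = cycle_class_matrix Bs P"
  have A: "dim_col A = length P" by (simp add: A_def cycle_class_matrix_def)
  interpret Q: comm_group "univ_group A" by (rule comm_group_univ_group)
  interpret S: comm_group "split_group U" by (rule comm_group_split_group)
  have "set (gens U) = \<theta> ` class_gen A ` {..<dim_col A}"
    unfolding U(4) A A_def[symmetric] by (simp add: image_comp atLeast0LessThan)
  then show "set (gens U) \<subseteq> carrier (split_group U)"
      "generate (split_group U) (set (gens U)) = carrier (split_group U)"
    using generate_iso[OF Q.is_group S.is_group U(3)[folded A_def] generate_class_gens] by simp_all
  have "l v \<in> carrier (univ_group A)" if "v \<in> pverts G" for v
    using path_labels_closed[OF Q.is_group _ U(5)[folded A_def] that] dart_gen_closed[OF assms(2) A]
    by blast
  then show "labels U ` pverts G \<subseteq> carrier (split_group U)"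
    using U(3) unfolding U(6) A_def by (auto simp: Group.iso_iff)
  show "0 \<notin> set (torsion U)" by fact
qed

section \<open>Finiteness of fold quotients\<close>

lemma nat_pow_DirProd: "(a, b) [^]\<^bsub>G \<times>\<times> H\<^esub> (m::nat) = (a [^]\<^bsub>G\<^esub> m, b [^]\<^bsub>H\<^esub> m)"
  by (induction m) (auto simp: nat_pow_def DirProd_def)

lemma prod_list_pos: "(\<And>x. x \<in> set xs \<Longrightarrow> 0 < x) \<Longrightarrow> 0 < prod_list (xs :: int list)"
  by (induction xs) auto

lemma det_hnf_basis_pos:
  assumes "hnf_basis f H" shows "0 < det H"
proof -
  have "det H = prod_list (diag_mat H)"
    using assms by (intro det_upper_triangular) (auto simp: hnf_basis_def)
  moreover have "0 < prod_list (diag_mat H)"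
    using assms by (intro prod_list_pos) (auto simp: hnf_basis_def diag_mat_def)
  ultimately show ?thesis by simp
qed

text \<open>Multiplying by the adjugate shows that the determinant annihilates the quotient.\<close>

lemma det_scale_mem_row_lattice:
  assumes "H \<in> carrier_mat f f"
  shows "(\<lambda>j\<in>{..<f}. det H * b j) \<in> row_lattice H"
proof -
  have dim: "dim_row H = f" "dim_col H = f" using assms by auto
  define y where "y = (\<lambda>i\<in>{..<f}. \<Sum>k<f. b k * adj_mat H $$ (k, i))"
  have "(\<Sum>i<f. y i * H $$ (i, j)) = det H * b j" if "j < f" for j
  proof -
    have "(\<Sum>i<f. y i * H $$ (i, j)) = (\<Sum>i<f. \<Sum>k<f. b k * (adj_mat H $$ (k, i) * H $$ (i, j)))"
      by (intro sum.cong) (auto simp: y_def sum_distrib_right mult.assoc)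
    also have "\<dots> = (\<Sum>k<f. b k * (\<Sum>i<f. adj_mat H $$ (k, i) * H $$ (i, j)))"
      by (subst sum.swap) (simp add: sum_distrib_left)
    also have "\<dots> = (\<Sum>k<f. b k * (if k = j then det H else 0))"
    proof (intro sum.cong refl arg_cong2[where f = "(*)"])
      fix k assume "k \<in> {..<f}"
      then have k: "k < f" by simp
      have "(\<Sum>i<f. adj_mat H $$ (k, i) * H $$ (i, j)) = (adj_mat H * H) $$ (k, j)"
        using k that assms adj_mat(1)[OF assms]
        by (auto simp: scalar_prod_def atLeast0LessThan intro!: sum.cong)
      also have "\<dots> = (if k = j then det H else 0)"
        using k that by (simp add: adj_mat(3)[OF assms])
      finally show "(\<Sum>i<f. adj_mat H $$ (k, i) * H $$ (i, j)) = (if k = j then det H else 0)" .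
    qed
    also have "\<dots> = det H * b j"
      using that by (simp add: if_distrib cong: if_cong)
    finally show ?thesis .
  qed
  then have "(\<lambda>j\<in>{..<f}. det H * b j) =
      (\<lambda>j\<in>{..<dim_col H}. \<Sum>i<dim_row H. y i * H $$ (i, j))"
    unfolding dim by (intro restrict_ext) simp
  moreover have "y \<in> carrier (Zpow (dim_row H))"
    by (simp add: carrier_Zpow y_def dim)
  ultimately show ?thesis unfolding row_lattice_def by blast
qed

lemma subgroup_fold_lattice:
  assumes "H \<in> carrier_mat (free_rank U) (free_rank U)"
  shows "subgroup ({\<one>\<^bsub>cyclic_product (torsion U)\<^esub>} \<times> row_lattice H) (split_group U)"
proof -
  interpret T: comm_group "cyclic_product (torsion U)" by (rule comm_group_cyclic_product)
  interpret Z: comm_group "Zpow (free_rank U)" by (rule comm_group_Zpow)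
  have "subgroup (row_lattice H) (Zpow (free_rank U))"
    using subgroup_row_lattice[of H] assms by simp
  then show ?thesis
    unfolding split_group_def
    by (intro DirProd_subgroups T.triv_subgroup T.is_group Z.is_group)
qed

text \<open>The exponent is the order of the torsion part times the determinant of \<open>H\<close>:
  the first factor annihilates every cyclic coordinate, and the second pushes the free part into the
  row lattice.\<close>

lemma fold_quotient_torsion:
  fixes U :: "'v univ_data"
  defines "L \<equiv> \<lambda>H. {\<one>\<^bsub>cyclic_product (torsion U)\<^esub>} \<times> row_lattice H"
  assumes "0 \<notin> set (torsion U)" "hnf_basis (free_rank U) H" "x \<in> carrier (split_group U Mod L H)"
  shows "\<exists>m::nat. 0 < m \<and> x [^]\<^bsub>split_group U Mod L H\<^esub> m = \<one>\<^bsub>split_group U Mod L H\<^esub>"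
proof -
  interpret T: comm_group "cyclic_product (torsion U)" by (rule comm_group_cyclic_product)
  interpret Z: comm_group "Zpow (free_rank U)" by (rule comm_group_Zpow)
  interpret S: comm_group "split_group U" by (rule comm_group_split_group)
  have H: "H \<in> carrier_mat (free_rank U) (free_rank U)" using assms(3) by (simp add: hnf_basis_def)
  have sub: "subgroup (L H) (split_group U)" unfolding L_def by (rule subgroup_fold_lattice[OF H])
  interpret N: normal "L H" "split_group U" using sub by (rule S.subgroup_imp_normal)
  interpret \<pi>: group_hom "split_group U" "split_group U Mod L H" "\<lambda>x. L H #>\<^bsub>split_group U\<^esub> x"
    using N.r_coset_hom_Mod N.factorgroup_is_group S.is_group
    by (simp add: group_hom_def group_hom_axioms_def)
  obtain a b where ab: "a \<in> carrier (cyclic_product (torsion U))" "b \<in> carrier (Zpow (free_rank U))"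
      "(a, b) \<in> carrier (split_group U)" "x = L H #>\<^bsub>split_group U\<^esub> (a, b)"
    using assms(4) by (auto simp: carrier_FactGroup split_group_def DirProd_def)
  define k where "k = prod_list (torsion U)"
  have k: "0 < k" unfolding k_def
    using assms(2) by (simp add: prod_list_zero_iff zero_less_iff_neq_zero)
  define m where "m = k * nat (det H)"
  have det: "0 < det H" using det_hnf_basis_pos assms(3) .
  have a: "a [^]\<^bsub>cyclic_product (torsion U)\<^esub> m = \<one>\<^bsub>cyclic_product (torsion U)\<^esub>"
  proof (rule extensionalityI[of _ "{..<length (torsion U)}"])
    show "a [^]\<^bsub>cyclic_product (torsion U)\<^esub> m \<in> extensional {..<length (torsion U)}"
      using T.nat_pow_closed[OF ab(1), of m] by (simp add: cyclic_product_def PiE_def)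
    fix i assume i: "i \<in> {..<length (torsion U)}"
    have "torsion U ! i dvd m"
      unfolding m_def k_def using i by (intro dvd_mult2 prod_list_dvd) simp
    then have "int m mod int (torsion U ! i) = 0"
      by (metis dvd_imp_mod_0 of_nat_dvd_iff)
    then show "(a [^]\<^bsub>cyclic_product (torsion U)\<^esub> m) i = \<one>\<^bsub>cyclic_product (torsion U)\<^esub> i"
      unfolding cyclic_product_def using i by (simp add: nat_pow_product_group mod_mult_left_eq[symmetric])
  qed (simp add: cyclic_product_def)
  have "b [^]\<^bsub>Zpow (free_rank U)\<^esub> m = (\<lambda>j\<in>{..<free_rank U}. det H * (int k * b j))"
  proof (rule extensionalityI)
    show "b [^]\<^bsub>Zpow (free_rank U)\<^esub> m \<in> extensional {..<free_rank U}"
      using Z.nat_pow_closed[OF ab(2), of m] by (simp add: carrier_Zpow)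
    show "(b [^]\<^bsub>Zpow (free_rank U)\<^esub> m) j = (\<lambda>j\<in>{..<free_rank U}. det H * (int k * b j)) j"
      if "j \<in> {..<free_rank U}" for j
      using that det unfolding Zpow_def by (simp add: nat_pow_product_group m_def)
  qed simp
  then have "b [^]\<^bsub>Zpow (free_rank U)\<^esub> m \<in> row_lattice H"
    using det_scale_mem_row_lattice[OF H] by simp
  then have "(a, b) [^]\<^bsub>split_group U\<^esub> m \<in> L H"
    unfolding split_group_def nat_pow_DirProd L_def a by simp
  then have "L H #>\<^bsub>split_group U\<^esub> (a, b) [^]\<^bsub>split_group U\<^esub> m = L H"
    using S.coset_join2[OF S.nat_pow_closed[OF ab(3)] sub] by blast
  then have "x [^]\<^bsub>split_group U Mod L H\<^esub> m = \<one>\<^bsub>split_group U Mod L H\<^esub>"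
    unfolding ab(4) using \<pi>.hom_nat_pow[OF ab(3), of m] by simp
  then show ?thesis using k det by (intro exI[of _ m]) (simp add: m_def)
qed

section \<open>Hosts from finite quotients\<close>

lemma ex_presents:
  assumes "comm_group Q" "finite Y" "Y \<subseteq> carrier Q" "generate Q Y = carrier Q"
    and "\<And>x. x \<in> carrier Q \<Longrightarrow> \<exists>m::nat. 0 < m \<and> x [^]\<^bsub>Q\<^esub> m = \<one>\<^bsub>Q\<^esub>"
  shows "\<exists>h. presents Q X l h"
proof -
  obtain Ns \<psi> where "0 \<notin> set Ns" "\<psi> \<in> iso Q (cyclic_product Ns)"
    using comm_group.ex_iso_finite_cyclic_product[OF assms] by blast
  then show ?thesis
    unfolding presents_def
    by (intro exI[of _ "\<lparr>moduli = Ns, conn = \<psi> ` (X \<union> m_inv Q ` X - {\<one>\<^bsub>Q\<^esub>}), emb = \<psi> \<circ> l\<rparr>"]) auto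
qed

text \<open>What the final guarantee says about a host apart from distances and size. It is
  established for candidates that fail the check as well.\<close>

definition proper_host :: "'v pair_pre_digraph \<Rightarrow> 'v host \<Rightarrow> bool" where
  "proper_host G h \<longleftrightarrow>
     0 \<notin> set (moduli h) \<and> connection_set (host_group h) (conn h) \<and>
     emb h ` pverts G \<subseteq> carrier (host_group h)"

lemma presents_proper_host:
  assumes "comm_group Q" "X \<subseteq> carrier Q" "generate Q X = carrier Q"
    and "presents Q X l h" "l ` pverts G \<subseteq> carrier Q"
  shows "proper_host G h"
proof -
  interpret Q: comm_group Q by fact
  interpret H: comm_group "host_group h" by (rule comm_group_cyclic_product)
  obtain \<psi> where \<psi>: "\<psi> \<in> iso Q (host_group h)"
      "conn h = \<psi> ` (X \<union> m_inv Q ` X - {\<one>\<^bsub>Q\<^esub>})" "emb h = \<psi> \<circ> l" and "0 \<notin> set (moduli h)"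
    using assms(4) unfolding presents_def by blast
  interpret \<psi>: group_hom Q "host_group h" \<psi>
    using \<psi>(1) by unfold_locales (simp add: iso_imp_homomorphism)
  define Y where "Y = X \<union> m_inv Q ` X - {\<one>\<^bsub>Q\<^esub>}"
  have Y: "Y \<subseteq> carrier Q" using assms(2) by (auto simp: Y_def)
  \<comment> \<open>A class generator may become trivial in the quotient; deleting it from the
    connection set loses nothing, since every subgroup contains the identity.\<close>
  have "carrier Q \<subseteq> generate Q Y"
    unfolding assms(3)[symmetric]
  proof (rule Q.generate_subgroup_incl[OF _ Q.generate_is_subgroup[OF Y]], rule subsetI)
    fix x assume "x \<in> X"
    then show "x \<in> generate Q Y"
      by (cases "x = \<one>\<^bsub>Q\<^esub>") (auto simp: Y_def intro: generate.one generate.incl)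
  qed
  then have gen: "generate Q Y = carrier Q" using Q.generate_incl[OF Y] by blast
  have "inv\<^bsub>Q\<^esub> y \<in> Y" if "y \<in> Y" for y
    using that assms(2) by (auto simp: Y_def)
  moreover have "m_inv Q ` Y = Y" if "\<And>y. y \<in> Y \<Longrightarrow> inv\<^bsub>Q\<^esub> y \<in> Y"
  proof
    show "m_inv Q ` Y \<subseteq> Y" using that by blast
    show "Y \<subseteq> m_inv Q ` Y"
    proof
      fix y assume "y \<in> Y"
      then have "y = inv\<^bsub>Q\<^esub> (inv\<^bsub>Q\<^esub> y)" "inv\<^bsub>Q\<^esub> y \<in> Y" using Y that by auto
      then show "y \<in> m_inv Q ` Y" by blast
    qed
  qed
  ultimately have inv_Y: "m_inv Q ` Y = Y" by blast
  have "m_inv (host_group h) ` conn h = (\<lambda>y. inv\<^bsub>host_group h\<^esub> (\<psi> y)) ` Y"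
    unfolding \<psi>(2) Y_def[symmetric] by (simp add: image_image)
  also have "\<dots> = (\<lambda>y. \<psi> (inv\<^bsub>Q\<^esub> y)) ` Y"
    using Y by (intro image_cong) auto
  also have "\<dots> = conn h"
    unfolding \<psi>(2) Y_def[symmetric] by (subst (2) inv_Y[symmetric]) (simp add: image_image)
  finally have "m_inv (host_group h) ` conn h = conn h" .
  moreover have "conn h \<subseteq> carrier (host_group h) - {\<one>\<^bsub>host_group h\<^esub>}"
  proof -
    have "inj_on \<psi> (carrier Q)" using \<psi>(1) by (simp add: Group.iso_iff)
    then have "\<psi> y \<noteq> \<one>\<^bsub>host_group h\<^esub>" if "y \<in> Y" for y
      using that Y \<psi>.hom_one unfolding Y_def by (metis DiffE Q.one_closed inj_onD insertI1 subsetD)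
    then show ?thesis using Y unfolding \<psi>(2) Y_def[symmetric] by auto
  qed
  moreover have "generate (host_group h) (conn h) = carrier (host_group h)"
    using generate_iso(2)[OF Q.is_group H.is_group \<psi>(1) Y gen] unfolding \<psi>(2) Y_def .
  moreover have "emb h ` pverts G \<subseteq> carrier (host_group h)"
    using assms(5) unfolding \<psi>(3) by auto
  ultimately show ?thesis
    using \<open>0 \<notin> set (moduli h)\<close> by (simp add: proper_host_def connection_set_def)
qed

context pair_graph
begin

lemma
  assumes "universal G P U" "oriented_partition G P" "hnf_basis (free_rank U) H"
  shows ex_fold_host: "\<exists>h. fold_host U H h"
    and fold_host_proper: "fold_host U H h \<Longrightarrow> proper_host G h"
proof -
  interpret S: comm_group "split_group U" by (rule comm_group_split_group)
  define L where "L = {\<one>\<^bsub>cyclic_product (torsion U)\<^esub>} \<times> row_lattice H"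
  have sub: "subgroup L (split_group U)"
    unfolding L_def using assms(3) by (intro subgroup_fold_lattice) (simp add: hnf_basis_def)
  have Q: "comm_group (split_group U Mod L)" using sub by (rule S.abelian_FactGroup)
  note gen = S.generate_FactGroup[OF sub gens_closed[OF assms(1,2)] generate_gens[OF assms(1,2)]]
  have "\<exists>m::nat. 0 < m \<and> x [^]\<^bsub>split_group U Mod L\<^esub> m = \<one>\<^bsub>split_group U Mod L\<^esub>"
    if "x \<in> carrier (split_group U Mod L)" for x
    using fold_quotient_torsion[OF torsion_nonzero[OF assms(1,2)] assms(3)] that
    unfolding L_def by blast
  then show "\<exists>h. fold_host U H h"
    unfolding fold_host_def Let_def L_def[symmetric]
    by (intro ex_presents[OF Q _ gen]) simp_all
  assume "fold_host U H h"
  moreover have "(\<lambda>x. L #>\<^bsub>split_group U\<^esub> labels U x) ` pverts G \<subseteq> carrier (split_group U Mod L)"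
    using labels_closed[OF assms(1,2)] by (auto simp: carrier_FactGroup)
  ultimately show "proper_host G h"
    unfolding fold_host_def Let_def L_def[symmetric]
    by (intro presents_proper_host[OF Q gen]) (auto simp: comp_def)
qed

end

text \<open>Pivots are positive integers with product at most \<open>cap\<close>, so each is at most
  \<open>cap\<close>; entries above a pivot are smaller than it, and those below vanish. A zero in
  the torsion list would make every fold order 0 and the bound empty.\<close>

lemma finite_hnf_bases:
  assumes "0 \<notin> set (torsion U)"
  shows "finite {H. hnf_basis (free_rank U) H \<and> fold_order U H \<le> cap}"
proof -
  let ?f = "free_rank U"
  have "{H. hnf_basis ?f H \<and> fold_order U H \<le> cap} \<subseteq>
      (\<lambda>g. mat ?f ?f g) ` (({..<?f} \<times> {..<?f}) \<rightarrow>\<^sub>E {0..int cap})"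
  proof
    fix H assume "H \<in> {H. hnf_basis ?f H \<and> fold_order U H \<le> cap}"
    then have H: "hnf_basis ?f H" "fold_order U H \<le> cap" by auto
    have pos: "0 < H $$ (j, j)" if "j < ?f" for j using H(1) that by (simp add: hnf_basis_def)
    have "1 \<le> prod_list (torsion U)"
      using assms by (induction "torsion U" rule: list.induct) (metis One_nat_def Suc_leI gr0I prod_list_zero_iff)+
    then have prod: "(\<Prod>i<?f. H $$ (i, i)) \<le> int cap"
      using H(2) mult_le_mono1[of 1 "prod_list (torsion U)" "nat (\<Prod>i<?f. H $$ (i, i))"]
      unfolding fold_order_def by linarith
    have diag: "H $$ (j, j) \<le> int cap" if "j < ?f" for j
    proof -
      have "H $$ (j, j) * 1 \<le> H $$ (j, j) * (\<Prod>i\<in>{..<?f} - {j}. H $$ (i, i))"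
      proof (rule mult_left_mono)
        have "0 < (\<Prod>i\<in>{..<?f} - {j}. H $$ (i, i))" by (rule prod_pos) (simp add: pos)
        then show "1 \<le> (\<Prod>i\<in>{..<?f} - {j}. H $$ (i, i))" by simp
      qed (use pos[OF that] in simp)
      also have "\<dots> = (\<Prod>i<?f. H $$ (i, i))"
        using that by (subst prod.remove[of _ j]) auto
      finally show ?thesis using prod by simp
    qed
    have "H $$ (i, j) \<in> {0..int cap}" if "i < ?f" "j < ?f" for i j
    proof -
      consider "i < j" | "i = j" | "j < i" by linarith
      then show ?thesis
      proof cases
        case 1
        then have "0 \<le> H $$ (i, j)" "H $$ (i, j) < H $$ (j, j)"
          using H(1) that by (simp_all add: hnf_basis_def)
        then show ?thesis using diag[OF that(2)] by simp
      next
        case 2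
        then show ?thesis using diag[OF that(2)] pos[OF that(2)] by simp
      next
        case 3
        have "upper_triangular H" "dim_row H = ?f" using H(1) by (auto simp: hnf_basis_def)
        then have "H $$ (i, j) = 0" using 3 that by auto
        then show ?thesis by simp
      qed
    qed
    then have "restrict (($$) H) ({..<?f} \<times> {..<?f}) \<in> ({..<?f} \<times> {..<?f}) \<rightarrow>\<^sub>E {0..int cap}"
      by auto
    moreover have "H = mat ?f ?f (restrict (($$) H) ({..<?f} \<times> {..<?f}))"
      using H(1) by (intro eq_matI) (auto simp: hnf_basis_def)
    ultimately show "H \<in> (\<lambda>g. mat ?f ?f g) ` (({..<?f} \<times> {..<?f}) \<rightarrow>\<^sub>E {0..int cap})"
      by blast
  qed
  moreover have "finite (({..<?f} \<times> {..<?f}) \<rightarrow>\<^sub>E {0..int cap})"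
    by (intro finite_PiE) auto
  ultimately show ?thesis using finite_surj by blast
qed

lemma ex_fold_queue:
  assumes "0 \<notin> set (torsion U)"
  shows "\<exists>Hs. fold_queue cap U Hs"
proof -
  obtain Hs where Hs: "set Hs = {H. hnf_basis (free_rank U) H \<and> fold_order U H \<le> cap}" "distinct Hs"
    using finite_distinct_list[OF finite_hnf_bases[OF assms]] by blast
  then have "fold_queue cap U (sort_key (fold_order U) Hs)"
    unfolding fold_queue_def by simp
  then show ?thesis by blast
qed

section \<open>The binary host\<close>

lemma pair_wf_digraph_cayley:
  assumes "group \<Gamma>" "S \<subseteq> carrier \<Gamma>"
  shows "pair_wf_digraph (cayley \<Gamma> S)"
proof -
  interpret group \<Gamma> by fact
  show ?thesis using assms(2) by unfold_locales (auto simp: cayley_def)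
qed

context pair_graph
begin

lemma gdist_finite:
  assumes "connected (with_proj G)" "u \<in> pverts G" "v \<in> pverts G"
  shows "gdist G u v \<noteq> \<infinity>"
proof -
  obtain p where "awalk u p v"
    using reachable_if_connected[OF assms] by (auto simp: reachable_awalk)
  then have "\<exists>k. (u, v) \<in> parcs G ^^ k" using awalk_imp_relpow by blast
  then show ?thesis by (simp add: gdist_eq_Least[OF assms(2)])
qed

lemma proper_host_cayley:
  assumes "proper_host G h"
  shows "pair_wf_digraph (cayley (host_group h) (conn h))"
    and "u \<in> pverts G \<Longrightarrow> emb h u \<in> pverts (cayley (host_group h) (conn h))"
proof -
  interpret H: comm_group "host_group h" by (rule comm_group_cyclic_product)
  show "pair_wf_digraph (cayley (host_group h) (conn h))"
    using assms by (intro pair_wf_digraph_cayley H.is_group) (auto simp: proper_host_def connection_set_def)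
  show "u \<in> pverts G \<Longrightarrow> emb h u \<in> pverts (cayley (host_group h) (conn h))"
    using assms by (auto simp: proper_host_def cayley_def)
qed

text \<open>Distances of \<open>G\<close> are finite, so agreement rules out the truncation value
  infinity, and the search has returned the true Cayley distance. Vertices with a common image would
  be at distance 0, which gives injectivity.\<close>

lemma exact_check_imp_isometric:
  assumes "connected (with_proj G)" "proper_host G h" "exact_check G h"
  shows "isometric_embedding G (host_group h) (conn h) (emb h)"
proof -
  let ?C = "cayley (host_group h) (conn h)"
  interpret C: pair_wf_digraph ?C using proper_host_cayley(1)[OF assms(2)] .
  have dist: "gdist ?C (emb h u) (emb h v) = gdist G u v" if uv: "u \<in> pverts G" "v \<in> pverts G" for u v
  proof (cases "u = v")
    case True
    then show ?thesis
      using uv proper_host_cayley(2)[OF assms(2)] by (simp add: gdist_refl C.gdist_refl)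
  next
    case False
    then have "bfs_dist ?C (diam G) (emb h u) (emb h v) = gdist G u v"
      using assms(3) uv by (simp add: exact_check_def)
    then show ?thesis
      using gdist_finite[OF assms(1) uv] proper_host_cayley(2)[OF assms(2) uv(1)]
      by (auto simp: C.bfs_dist_eq_gdist split: if_splits)
  qed
  have "inj_on (emb h) (pverts G)"
  proof (rule inj_onI)
    fix u v assume uv: "u \<in> pverts G" "v \<in> pverts G" and "emb h u = emb h v"
    then have "gdist ?C (emb h u) (emb h v) = 0"
      using proper_host_cayley(2)[OF assms(2) uv(1)] by (simp add: C.gdist_refl)
    then show "u = v" using dist uv gdist_eq_0_imp_eq by simp
  qed
  then show ?thesis
    using dist assms(2) by (simp add: isometric_embedding_def proper_host_def)
qed

text \<open>The converse serves the binary host. Cutting off at the diameter loses nothing, since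
  the Cayley distances to be found are distances of \<open>G\<close>.\<close>

lemma isometric_imp_exact_check:
  assumes "connected (with_proj G)" "proper_host G h"
    and "\<And>u v. u \<in> pverts G \<Longrightarrow> v \<in> pverts G \<Longrightarrow>
      gdist (cayley (host_group h) (conn h)) (emb h u) (emb h v) = gdist G u v"
  shows "exact_check G h"
  unfolding exact_check_def
proof (intro ballI impI)
  let ?C = "cayley (host_group h) (conn h)"
  interpret C: pair_wf_digraph ?C using proper_host_cayley(1)[OF assms(2)] .
  fix u v assume uv: "u \<in> pverts G" "v \<in> pverts G"
  then show "bfs_dist ?C (diam G) (emb h u) (emb h v) = gdist G u v"
    using assms(3)[OF uv] gdist_finite[OF assms(1) uv] gdist_le_diam[OF uv]
      proper_host_cayley(2)[OF assms(2) uv(1)]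
    by (simp add: C.bfs_dist_eq_gdist)
qed

end

section \<open>The boundary map on the binary quotient\<close>

definition vertex_sums :: "'v pair_pre_digraph \<Rightarrow> ('v \<Rightarrow> int) monoid" where
  "vertex_sums G = product_group (pverts G) (\<lambda>_. integer_mod_group 2)"

text \<open>The incidence map over the field with two elements; its kernel is the binary cycle
  space.\<close>

definition boundary :: "'v pair_pre_digraph \<Rightarrow> ('v set \<Rightarrow> int) \<Rightarrow> 'v \<Rightarrow> int" where
  "boundary G x = (\<lambda>v\<in>pverts G. (\<Sum>e | e \<in> uedges G \<and> v \<in> e. x e) mod 2)"

text \<open>The map induced by \<open>boundary\<close> on cosets of its kernel: it is constant on
  each, so the image has one element.\<close>

definition coset_boundary :: "'v pair_pre_digraph \<Rightarrow> ('v set \<Rightarrow> int) set \<Rightarrow> 'v \<Rightarrow> int" where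
  "coset_boundary G X = the_elem (boundary G ` X)"

definition binary_quotient :: "'v pair_pre_digraph \<Rightarrow> ('v set \<Rightarrow> int) set monoid" where
  "binary_quotient G = F2E G Mod binary_cycle_space G"

context pair_graph
begin

lemma finite_uedges: "finite (uedges G)"
  by (simp add: uedges_def)

lemma uedge_cases:
  assumes "e \<in> uedges G"
  obtains u w where "e = {u, w}" "(u, w) \<in> parcs G" "u \<in> pverts G" "w \<in> pverts G" "u \<noteq> w"
  using assms by (auto simp: uedges_def dest: no_loops' in_arcsD1 in_arcsD2)

lemma uedge_endpoint:
  assumes "e \<in> uedges G" "u \<in> e"
  obtains w where "e = {u, w}" "(u, w) \<in> parcs G" "u \<noteq> w"
proof -
  obtain a b where ab: "e = {a, b}" "(a, b) \<in> parcs G" "a \<noteq> b"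
    using assms(1) by (rule uedge_cases)
  show thesis
  proof (cases "u = a")
    case False
    then have "u = b" using assms(2) ab(1) by simp
    then show thesis using that[of a] ab arcs_symmetric[OF ab(2)] by auto
  qed (use that[of b] ab in simp)
qed

lemma arc_in_uedges: "(u, v) \<in> parcs G \<Longrightarrow> {u, v} \<in> uedges G"
  by (auto simp: uedges_def)

lemma comm_group_F2E: "comm_group (F2E G)"
  unfolding F2E_def by (rule comm_group_product_group) simp

lemma comm_group_vertex_sums: "comm_group (vertex_sums G)"
  unfolding vertex_sums_def by (rule comm_group_product_group) simp

lemma group_hom_boundary: "group_hom (F2E G) (vertex_sums G) (boundary G)"
proof -
  interpret F: comm_group "F2E G" by (rule comm_group_F2E)
  interpret B: comm_group "vertex_sums G" by (rule comm_group_vertex_sums)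
  have "boundary G \<in> hom (F2E G) (vertex_sums G)"
  proof (rule homI)
    show "boundary G x \<in> carrier (vertex_sums G)" for x
      by (auto simp: boundary_def vertex_sums_def carrier_integer_mod_group)
    fix x y
    have "(\<Sum>e | e \<in> uedges G \<and> v \<in> e. (x \<otimes>\<^bsub>F2E G\<^esub> y) e) mod 2 =
        ((\<Sum>e | e \<in> uedges G \<and> v \<in> e. x e) mod 2 + (\<Sum>e | e \<in> uedges G \<and> v \<in> e. y e) mod 2) mod 2" for v
    proof -
      have "(\<Sum>e | e \<in> uedges G \<and> v \<in> e. (x \<otimes>\<^bsub>F2E G\<^esub> y) e) =
          (\<Sum>e | e \<in> uedges G \<and> v \<in> e. (x e + y e) mod 2)"
        by (intro sum.cong) (auto simp: F2E_def)
      then show ?thesis by (simp add: mod_sum_eq sum.distrib mod_add_eq)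
    qed
    then show "boundary G (x \<otimes>\<^bsub>F2E G\<^esub> y) = boundary G x \<otimes>\<^bsub>vertex_sums G\<^esub> boundary G y"
      by (simp add: boundary_def vertex_sums_def cong: restrict_cong)
  qed
  then show ?thesis by unfold_locales
qed

lemma kernel_boundary: "kernel (F2E G) (vertex_sums G) (boundary G) = binary_cycle_space G"
proof -
  have "boundary G x = \<one>\<^bsub>vertex_sums G\<^esub> \<longleftrightarrow>
      (\<forall>v\<in>pverts G. even (\<Sum>e | e \<in> uedges G \<and> v \<in> e. x e))" for x
    by (auto simp: boundary_def vertex_sums_def fun_eq_iff restrict_def even_iff_mod_2_eq_zero)
  then show ?thesis by (auto simp: kernel_def binary_cycle_space_def)
qed

lemma subgroup_binary_cycle_space: "subgroup (binary_cycle_space G) (F2E G)"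
  using group_hom.subgroup_kernel[OF group_hom_boundary] by (simp add: kernel_boundary)

lemma comm_group_binary_quotient: "comm_group (binary_quotient G)"
  unfolding binary_quotient_def
  using comm_group.abelian_FactGroup[OF comm_group_F2E subgroup_binary_cycle_space] .

lemma group_hom_coset_boundary: "group_hom (binary_quotient G) (vertex_sums G) (coset_boundary G)"
proof -
  interpret \<beta>: group_hom "F2E G" "vertex_sums G" "boundary G" by (rule group_hom_boundary)
  interpret Q: comm_group "binary_quotient G" by (rule comm_group_binary_quotient)
  show ?thesis
    using \<beta>.FactGroup_hom unfolding kernel_boundary coset_boundary_def[symmetric]
    by unfold_locales (simp add: binary_quotient_def)
qed

lemma inj_on_coset_boundary: "inj_on (coset_boundary G) (carrier (binary_quotient G))"
  using group_hom.FactGroup_inj_on[OF group_hom_boundary]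
  unfolding kernel_boundary coset_boundary_def[symmetric] binary_quotient_def .

lemma coset_boundary_coset:
  assumes "x \<in> carrier (F2E G)"
  shows "coset_boundary G (binary_cycle_space G #>\<^bsub>F2E G\<^esub> x) = boundary G x"
proof -
  interpret \<beta>: group_hom "F2E G" "vertex_sums G" "boundary G" by (rule group_hom_boundary)
  have "boundary G (z \<otimes>\<^bsub>F2E G\<^esub> x) = boundary G x" if "z \<in> binary_cycle_space G" for z
    using that assms \<beta>.hom_mult[of z x] unfolding kernel_boundary[symmetric] kernel_def by simp
  moreover have "binary_cycle_space G \<noteq> {}"
    using subgroup.one_closed[OF subgroup_binary_cycle_space] by blast
  moreover have "boundary G ` (binary_cycle_space G #>\<^bsub>F2E G\<^esub> x) =
      (\<lambda>z. boundary G (z \<otimes>\<^bsub>F2E G\<^esub> x)) ` binary_cycle_space G"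
    by (auto simp: r_coset_def)
  ultimately have "boundary G ` (binary_cycle_space G #>\<^bsub>F2E G\<^esub> x) = {boundary G x}"
    by (simp add: image_constant_conv cong: image_cong)
  then show ?thesis by (simp add: coset_boundary_def)
qed

lemma
  shows edge_gens_closed: "edge_gen G ` uedges G \<subseteq> carrier (binary_quotient G)"
    and generate_edge_gens:
      "generate (binary_quotient G) (edge_gen G ` uedges G) = carrier (binary_quotient G)"
    and coset_boundary_edge_gen: "e \<in> uedges G \<Longrightarrow>
      coset_boundary G (edge_gen G e) = (\<lambda>v\<in>pverts G. if v \<in> e then 1 else 0)"
proof -
  define u :: "'a set \<Rightarrow> 'a set \<Rightarrow> int"
    where "u = (\<lambda>e. \<lambda>e'\<in>uedges G. if e' = e then 1 else 0)"
  have u: "u ` uedges G \<subseteq> carrier (F2E G)"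
      "generate (F2E G) (u ` uedges G) = carrier (F2E G)"
    unfolding F2E_def u_def using generate_product_units[OF finite_uedges, of 2] by simp_all
  have "edge_gen G ` uedges G = (\<lambda>x. binary_cycle_space G #>\<^bsub>F2E G\<^esub> x) ` u ` uedges G"
    by (simp add: image_image edge_gen_def u_def)
  then show "edge_gen G ` uedges G \<subseteq> carrier (binary_quotient G)"
      "generate (binary_quotient G) (edge_gen G ` uedges G) = carrier (binary_quotient G)"
    unfolding binary_quotient_def
    using comm_group.generate_FactGroup[OF comm_group_F2E subgroup_binary_cycle_space u] by simp_all
  assume e: "e \<in> uedges G"
  have "(\<Sum>e' | e' \<in> uedges G \<and> v \<in> e'. u e e') = (if v \<in> e then 1 else 0)" for v
  proof -
    have "(\<Sum>e' | e' \<in> uedges G \<and> v \<in> e'. u e e') =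
        (\<Sum>e' | e' \<in> uedges G \<and> v \<in> e'. if e' = e then 1 else 0)"
      by (intro sum.cong) (auto simp: u_def)
    then show ?thesis using e finite_uedges by simp
  qed
  then have "boundary G (u e) = (\<lambda>v\<in>pverts G. if v \<in> e then 1 else 0)"
    unfolding boundary_def by (auto intro!: restrict_ext)
  moreover have "u e \<in> carrier (F2E G)" using u(1) e by blast
  ultimately show "coset_boundary G (edge_gen G e) = (\<lambda>v\<in>pverts G. if v \<in> e then 1 else 0)"
    using coset_boundary_coset[of "u e"] by (simp add: edge_gen_def u_def)
qed

lemma coset_boundary_mult:
  assumes "x \<in> carrier (binary_quotient G)" "y \<in> carrier (binary_quotient G)" "v \<in> pverts G"
  shows "coset_boundary G (x \<otimes>\<^bsub>binary_quotient G\<^esub> y) v =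
    (coset_boundary G x v + coset_boundary G y v) mod 2"
  using group_hom.hom_mult[OF group_hom_coset_boundary assms(1,2)] assms(3)
  by (simp add: vertex_sums_def)

lemma coset_boundary_range:
  assumes "x \<in> carrier (binary_quotient G)" "v \<in> pverts G"
  shows "coset_boundary G x v \<in> {0, 1}"
proof -
  have "coset_boundary G x \<in> carrier (vertex_sums G)"
    using group_hom.hom_closed[OF group_hom_coset_boundary assms(1)] .
  then have "coset_boundary G x v \<in> {0..<2}"
    using assms(2) by (auto simp: vertex_sums_def carrier_integer_mod_group)
  then show ?thesis by auto
qed

text \<open>Injectivity of the induced boundary lets identities in the quotient be checked one
  vertex at a time, by arithmetic modulo 2.\<close>

lemma coset_boundary_eqI:
  assumes "x \<in> carrier (binary_quotient G)" "y \<in> carrier (binary_quotient G)"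
    and "\<And>v. v \<in> pverts G \<Longrightarrow> coset_boundary G x v = coset_boundary G y v"
  shows "x = y"
proof (rule inj_onD[OF inj_on_coset_boundary _ assms(1,2)])
  have "coset_boundary G z \<in> carrier (vertex_sums G)" if "z \<in> carrier (binary_quotient G)" for z
    using group_hom.hom_closed[OF group_hom_coset_boundary that] .
  then have "coset_boundary G x \<in> extensional (pverts G)" "coset_boundary G y \<in> extensional (pverts G)"
    using assms(1,2) by (simp_all add: vertex_sums_def PiE_def)
  then show "coset_boundary G x = coset_boundary G y"
    using assms(3) by (rule extensionalityI)
qed

lemma coset_boundary_one: "v \<in> pverts G \<Longrightarrow> coset_boundary G \<one>\<^bsub>binary_quotient G\<^esub> v = 0"
  using group_hom.hom_one[OF group_hom_coset_boundary] by (simp add: vertex_sums_def)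

lemma binary_quotient_square:
  assumes "x \<in> carrier (binary_quotient G)"
  shows "x \<otimes>\<^bsub>binary_quotient G\<^esub> x = \<one>\<^bsub>binary_quotient G\<^esub>"
proof -
  interpret Q: comm_group "binary_quotient G" by (rule comm_group_binary_quotient)
  show ?thesis
    using assms coset_boundary_range[OF assms]
    by (intro coset_boundary_eqI) (auto simp: coset_boundary_mult coset_boundary_one)
qed

text \<open>Double counting: every edge contributes its coefficient at both of its ends.\<close>

lemma even_sum_boundary: "even (\<Sum>v\<in>pverts G. boundary G x v)"
proof -
  have "(\<Sum>v\<in>pverts G. boundary G x v) mod 2 =
      (\<Sum>v\<in>pverts G. \<Sum>e | e \<in> uedges G \<and> v \<in> e. x e) mod 2"
    unfolding boundary_def by (simp add: mod_sum_eq)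
  also have "(\<Sum>v\<in>pverts G. \<Sum>e | e \<in> uedges G \<and> v \<in> e. x e) =
      (\<Sum>e\<in>uedges G. \<Sum>v | v \<in> pverts G \<and> v \<in> e. x e)"
    by (rule sum.swap_restrict[OF pair_finite_verts finite_uedges])
  also have "\<dots> = (\<Sum>e\<in>uedges G. 2 * x e)"
  proof (intro sum.cong refl)
    fix e assume "e \<in> uedges G"
    then obtain u w where uw: "e = {u, w}" "u \<in> pverts G" "w \<in> pverts G" "u \<noteq> w"
      by (rule uedge_cases)
    then have "{v. v \<in> pverts G \<and> v \<in> e} = {u, w}" by auto
    then show "(\<Sum>v | v \<in> pverts G \<and> v \<in> e. x e) = 2 * x e" using uw(4) by simp
  qed
  finally show ?thesis by (simp add: even_iff_mod_2_eq_zero flip: sum_distrib_left)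
qed

text \<open>A coset is determined by its boundary away from one vertex, since boundaries are even.\<close>

lemma order_binary_quotient:
  assumes "pverts G \<noteq> {}"
  shows "finite (carrier (binary_quotient G))"
    and "order (binary_quotient G) \<le> 2 ^ (card (pverts G) - 1)"
proof -
  obtain r where r: "r \<in> pverts G" using assms by blast
  define s where "s x = {v \<in> pverts G - {r}. coset_boundary G x v = 1}" for x
  have inj: "inj_on s (carrier (binary_quotient G))"
  proof (rule inj_onI)
    fix x y assume xy: "x \<in> carrier (binary_quotient G)" "y \<in> carrier (binary_quotient G)" "s x = s y"
    have eq: "coset_boundary G x v = coset_boundary G y v" if "v \<in> pverts G - {r}" for v
    proof -
      have "v \<in> s x \<longleftrightarrow> v \<in> s y" using xy(3) by simp
      then have "coset_boundary G x v = 1 \<longleftrightarrow> coset_boundary G y v = 1"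
        using that unfolding s_def by blast
      moreover have "coset_boundary G x v \<in> {0, 1}" "coset_boundary G y v \<in> {0, 1}"
        using that xy(1,2) coset_boundary_range by blast+
      ultimately show ?thesis by auto
    qed
    have even: "even (\<Sum>v\<in>pverts G. coset_boundary G z v)" if "z \<in> carrier (binary_quotient G)" for z
      using that even_sum_boundary coset_boundary_coset
      by (auto simp: binary_quotient_def carrier_FactGroup)
    have "(\<Sum>v\<in>pverts G. coset_boundary G z v) =
        coset_boundary G z r + (\<Sum>v\<in>pverts G - {r}. coset_boundary G z v)" for z
      using r by (simp add: sum.remove)
    moreover have "(\<Sum>v\<in>pverts G - {r}. coset_boundary G x v) = (\<Sum>v\<in>pverts G - {r}. coset_boundary G y v)"
      using eq by (intro sum.cong) auto
    ultimately have "even (coset_boundary G x r) \<longleftrightarrow> even (coset_boundary G y r)"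
      using even[OF xy(1)] even[OF xy(2)] by (metis even_add)
    then have "coset_boundary G x r = coset_boundary G y r"
      using coset_boundary_range[OF xy(1) r] coset_boundary_range[OF xy(2) r] by auto
    then show "x = y"
      using eq xy by (intro coset_boundary_eqI) auto
  qed
  have sub: "s ` carrier (binary_quotient G) \<subseteq> Pow (pverts G - {r})" by (auto simp: s_def)
  have fin: "finite (Pow (pverts G - {r}))" by simp
  show "finite (carrier (binary_quotient G))"
    using inj sub fin by (meson finite_imageD finite_subset)
  have "order (binary_quotient G) \<le> card (Pow (pverts G - {r}))"
    unfolding order_def using card_inj_on_le[OF inj sub fin] .
  also have "\<dots> = 2 ^ (card (pverts G) - 1)"
    using r by (simp add: card_Pow)
  finally show "order (binary_quotient G) \<le> 2 ^ (card (pverts G) - 1)" .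
qed

section \<open>Labels and walks in the binary host\<close>

lemma edge_label_closed: "a \<in> parcs G \<Longrightarrow> (\<lambda>(u, v). edge_gen G {u, v}) a \<in> carrier (binary_quotient G)"
  using edge_gens_closed arc_in_uedges by (cases a) auto

text \<open>Every visit to an inner vertex enters and leaves it, so its contributions cancel modulo
  2. Only the ends remain, hence a label does not depend on the path chosen for it.\<close>

lemma coset_boundary_path_sum:
  assumes "pcas u p v" "set p \<subseteq> parcs G" "u \<in> pverts G" "w \<in> pverts G"
  shows "coset_boundary G (path_sum (binary_quotient G) (\<lambda>(u, v). edge_gen G {u, v}) p) w =
    (of_bool (w = u) + of_bool (w = v)) mod 2"
  using assms(1-3)
proof (induction p arbitrary: u)
  case Nil
  then show ?case using assms(4) by (simp add: path_sum_def coset_boundary_one)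
next
  case (Cons a p)
  interpret Q: comm_group "binary_quotient G" by (rule comm_group_binary_quotient)
  obtain b where a: "a = (u, b)" "(u, b) \<in> parcs G" using Cons.prems by (cases a) auto
  have b: "b \<in> pverts G" "u \<noteq> b" using a in_arcsD2 no_loops' by auto
  let ?\<gamma> = "\<lambda>(u, v). edge_gen G {u, v}"
  have closed: "path_sum (binary_quotient G) ?\<gamma> p \<in> carrier (binary_quotient G)"
    if "set p \<subseteq> parcs G" for p
    using that edge_label_closed by (induction p) (auto simp: path_sum_def)
  have "path_sum (binary_quotient G) ?\<gamma> (a # p) =
      edge_gen G {u, b} \<otimes>\<^bsub>binary_quotient G\<^esub> path_sum (binary_quotient G) ?\<gamma> p"
    by (simp add: path_sum_def a(1))
  also have "coset_boundary G \<dots> w =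
      (coset_boundary G (edge_gen G {u, b}) w +
       coset_boundary G (path_sum (binary_quotient G) ?\<gamma> p) w) mod 2"
    using edge_gens_closed arc_in_uedges[OF a(2)] closed Cons.prems(2) assms(4)
    by (intro coset_boundary_mult) auto
  also have "coset_boundary G (path_sum (binary_quotient G) ?\<gamma> p) w =
      (of_bool (w = b) + of_bool (w = v)) mod 2"
    using Cons.prems a b by (intro Cons.IH) auto
  also have "coset_boundary G (edge_gen G {u, b}) w = of_bool (w = u) + of_bool (w = b)"
    using coset_boundary_edge_gen[OF arc_in_uedges[OF a(2)]] assms(4) b(2) by auto
  finally show ?case by auto
qed

text \<open>Some edge leaves \<open>u\<close>; removing it moves the odd degree to its other end.\<close>

lemma odd_degrees_imp_path:
  assumes "set es \<subseteq> uedges G" "u \<in> pverts G"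
    and "\<And>w. w \<in> pverts G \<Longrightarrow> odd (length (filter (\<lambda>e. w \<in> e) es)) \<longleftrightarrow> (w = u) \<noteq> (w = v)"
  shows "\<exists>j\<le>length es. (u, v) \<in> parcs G ^^ j"
  using assms
proof (induction "length es" arbitrary: es u)
  case 0
  \<comment> \<open>The empty list has even degree at \<open>u\<close>, so the parity hypothesis at
    \<open>u\<close> itself forces equality.\<close>
  then have "u = v" by auto
  then show ?case by auto
next
  case (Suc n)
  show ?case
  proof (cases "u = v")
    case True
    then show ?thesis by (intro exI[of _ 0]) simp
  next
    case False
    then have "odd (length (filter (\<lambda>e. u \<in> e) es))" using Suc.prems(2,3) by simp
    then have "filter (\<lambda>e. u \<in> e) es \<noteq> []" by fastforce
    then obtain e where e: "e \<in> set es" "u \<in> e" by (auto simp: filter_empty_conv)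
    then obtain es1 es2 where es: "es = es1 @ e # es2" by (meson split_list)
    obtain b where b: "e = {u, b}" "(u, b) \<in> parcs G" "u \<noteq> b"
      using Suc.prems(1) e by (meson subsetD uedge_endpoint)
    have "odd (length (filter (\<lambda>e. w \<in> e) (es1 @ es2))) \<longleftrightarrow> (w = b) \<noteq> (w = v)"
      if "w \<in> pverts G" for w
      using Suc.prems(3)[OF that] b False unfolding es by auto
    then have "\<exists>j\<le>length (es1 @ es2). (b, v) \<in> parcs G ^^ j"
      using Suc.prems(1) Suc.hyps(2) es b(2) in_arcsD2 by (intro Suc.hyps(1)) auto
    then obtain j where "j \<le> length (es1 @ es2)" "(b, v) \<in> parcs G ^^ j" by blast
    then show ?thesis
      using relpow_Suc_I2[OF b(2)] es by (intro exI[of _ "Suc j"]) auto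
  qed
qed

lemma ex_binary_host:
  assumes "connected (with_proj G)"
  shows "\<exists>h. binary_host G h"
proof -
  interpret Q: comm_group "binary_quotient G" by (rule comm_group_binary_quotient)
  obtain l where "path_labels G (binary_quotient G) (\<lambda>(u, v). edge_gen G {u, v}) l"
    using ex_path_labels[OF assms] by blast
  moreover have "\<exists>h. presents (binary_quotient G) (edge_gen G ` uedges G) l h"
  proof (rule ex_presents[OF Q.comm_group_axioms _ edge_gens_closed generate_edge_gens])
    show "finite (edge_gen G ` uedges G)" using finite_uedges by simp
    fix x assume "x \<in> carrier (binary_quotient G)"
    then have "x [^]\<^bsub>binary_quotient G\<^esub> (2::nat) = \<one>\<^bsub>binary_quotient G\<^esub>"
      using binary_quotient_square by (simp add: numeral_2_eq_2)
    then show "\<exists>m::nat. 0 < m \<and> x [^]\<^bsub>binary_quotient G\<^esub> m = \<one>\<^bsub>binary_quotient G\<^esub>"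
      by (intro exI[of _ 2]) simp
  qed
  ultimately show ?thesis
    unfolding binary_host_def Let_def binary_quotient_def by blast
qed

text \<open>The isomorphism \<open>\<psi>\<close> moves every question to the quotient, where
  elements are read off from their boundaries. The size bound comes from bijectivity. The check
  reduces to comparing walk lengths in both directions, the harder one leading from Cayley walks
  back to \<open>G\<close>.\<close>

lemma
  assumes "connected (with_proj G)" "binary_host G h"
  shows binary_host_proper: "proper_host G h"
    and binary_host_exact: "exact_check G h"
    and binary_host_order: "order (host_group h) \<le> 2 ^ (card (pverts G) - 1)"
proof -
  let ?\<gamma> = "\<lambda>(u, v). edge_gen G {u, v}"
  let ?C = "cayley (host_group h) (conn h)"
  interpret Q: comm_group "binary_quotient G" by (rule comm_group_binary_quotient)
  interpret H: comm_group "host_group h" by (rule comm_group_cyclic_product)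
  obtain l where l: "path_labels G (binary_quotient G) ?\<gamma> l"
    and pres: "presents (binary_quotient G) (edge_gen G ` uedges G) l h"
    using assms(2) unfolding binary_host_def Let_def binary_quotient_def by blast
  have l_closed: "l v \<in> carrier (binary_quotient G)" if "v \<in> pverts G" for v
    using path_labels_closed[OF Q.is_group edge_label_closed l that] .
  show proper: "proper_host G h"
    using l_closed by (intro presents_proper_host[OF Q.comm_group_axioms edge_gens_closed generate_edge_gens pres]) auto
  obtain r where r: "r \<in> pverts G"
    and lr: "\<And>v. v \<in> pverts G \<Longrightarrow> \<exists>p. apath r p v \<and> l v = path_sum (binary_quotient G) ?\<gamma> p"
    using l unfolding path_labels_def by blast
  have bd_l: "coset_boundary G (l v) w = (of_bool (w = r) + of_bool (w = v)) mod 2"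
    if "v \<in> pverts G" "w \<in> pverts G" for v w
    using lr[OF that(1)] coset_boundary_path_sum[OF _ _ r that(2)]
    by (auto simp: apath_def awalk_def)
  obtain \<psi> where \<psi>: "\<psi> \<in> iso (binary_quotient G) (host_group h)"
    "conn h = \<psi> ` (edge_gen G ` uedges G \<union> m_inv (binary_quotient G) ` edge_gen G ` uedges G
      - {\<one>\<^bsub>binary_quotient G\<^esub>})" "emb h = \<psi> \<circ> l"
    using pres unfolding presents_def by blast
  interpret \<psi>: group_hom "binary_quotient G" "host_group h" \<psi>
    using \<psi>(1) by unfold_locales (simp add: iso_imp_homomorphism)
  have bij: "bij_betw \<psi> (carrier (binary_quotient G)) (carrier (host_group h))"
    using \<psi>(1) by (simp add: iso_def)
  have "order (host_group h) = order (binary_quotient G)"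
    unfolding order_def using bij_betw_same_card[OF bij] by simp
  then show "order (host_group h) \<le> 2 ^ (card (pverts G) - 1)"
    using order_binary_quotient(2) r by auto
  have gen: "edge_gen G e \<in> carrier (binary_quotient G)" "edge_gen G e \<noteq> \<one>\<^bsub>binary_quotient G\<^esub>"
      "inv\<^bsub>binary_quotient G\<^esub> (edge_gen G e) = edge_gen G e" if e: "e \<in> uedges G" for e
  proof -
    show *: "edge_gen G e \<in> carrier (binary_quotient G)" using edge_gens_closed e by blast
    show "inv\<^bsub>binary_quotient G\<^esub> (edge_gen G e) = edge_gen G e"
      by (rule Q.inv_equality[OF binary_quotient_square[OF *] * *])
    obtain u w where "e = {u, w}" "u \<in> pverts G" using e by (rule uedge_cases)
    then have "coset_boundary G (edge_gen G e) u = 1"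
      using coset_boundary_edge_gen[OF e] by simp
    then show "edge_gen G e \<noteq> \<one>\<^bsub>binary_quotient G\<^esub>"
      using coset_boundary_one[OF \<open>u \<in> pverts G\<close>] by force
  qed
  \<comment> \<open>The generators are nontrivial involutions, so neither the closure under inverses
    nor the removal of the identity changes the set.\<close>
  have conn: "conn h = \<psi> ` edge_gen G ` uedges G"
    unfolding \<psi>(2) using gen(2,3) by (auto simp: image_iff)
  have arc: "(emb h u, emb h w) \<in> parcs ?C" if uw: "(u, w) \<in> parcs G" for u w
  proof -
    have e: "{u, w} \<in> uedges G" using arc_in_uedges[OF uw] .
    have V: "u \<in> pverts G" "w \<in> pverts G" "u \<noteq> w" using uw in_arcsD1 in_arcsD2 no_loops' by auto
    \<comment> \<open>Both sides have boundary {r} + {w}: adding {u, w} to {r} + {u} cancels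
      \<open>u\<close>.\<close>
    have "l w = l u \<otimes>\<^bsub>binary_quotient G\<^esub> edge_gen G {u, w}"
    proof (rule coset_boundary_eqI)
      fix v assume v: "v \<in> pverts G"
      have "coset_boundary G (l u \<otimes>\<^bsub>binary_quotient G\<^esub> edge_gen G {u, w}) v =
          ((of_bool (v = r) + of_bool (v = u)) mod 2 + (if v \<in> {u, w} then 1 else 0)) mod 2"
        using coset_boundary_mult[OF l_closed[OF V(1)] gen(1)[OF e] v] bd_l[OF V(1) v]
          coset_boundary_edge_gen[OF e] v by simp
      also have "\<dots> = (of_bool (v = r) + of_bool (v = w)) mod 2"
        using V(3) by auto
      finally show "coset_boundary G (l w) v =
          coset_boundary G (l u \<otimes>\<^bsub>binary_quotient G\<^esub> edge_gen G {u, w}) v"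
        using bd_l[OF V(2) v] by simp
    qed (use l_closed V gen(1)[OF e] in auto)
    then have "emb h w = emb h u \<otimes>\<^bsub>host_group h\<^esub> \<psi> (edge_gen G {u, w})"
      using l_closed[OF V(1)] gen(1)[OF e] by (simp add: \<psi>(3))
    moreover have "\<psi> (edge_gen G {u, w}) \<in> conn h" using e conn by blast
    moreover have "emb h u \<in> carrier (host_group h)" using l_closed[OF V(1)] by (simp add: \<psi>(3))
    ultimately show ?thesis unfolding cayley_def by auto
  qed
  have path: "(emb h u, emb h v) \<in> parcs ?C ^^ k" if "(u, v) \<in> parcs G ^^ k" for u v k
    using that
  proof (induction k arbitrary: v)
    case (Suc k)
    then obtain w where "(u, w) \<in> parcs G ^^ k" "(w, v) \<in> parcs G" by auto
    then show ?case using Suc.IH arc by auto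
  qed simp
  \<comment> \<open>A Cayley walk is recorded as the list of its edges, with repetitions and without
    regard to adjacency in \<open>G\<close>. Its effect on the boundary at \<open>w\<close> is the
    degree of \<open>w\<close> in that list.\<close>
  have edges: "\<exists>y es. y \<in> carrier (binary_quotient G) \<and> b = \<psi> y \<and> set es \<subseteq> uedges G \<and> length es = k \<and>
      (\<forall>w\<in>pverts G. coset_boundary G y w =
        (coset_boundary G x w + int (length (filter (\<lambda>e. w \<in> e) es))) mod 2)"
    if "(\<psi> x, b) \<in> parcs ?C ^^ k" "x \<in> carrier (binary_quotient G)" for x b k
    using that(1)
  proof (induction k arbitrary: b)
    case 0
    have "coset_boundary G x w = coset_boundary G x w mod 2" if "w \<in> pverts G" for w
      using coset_boundary_range[OF \<open>x \<in> carrier (binary_quotient G)\<close> that] by auto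
    then show ?case
      using 0 \<open>x \<in> carrier (binary_quotient G)\<close> by (intro exI[of _ x] exI[of _ "[]"]) auto
  next
    case (Suc k)
    then obtain c where c: "(\<psi> x, c) \<in> parcs ?C ^^ k" "(c, b) \<in> parcs ?C" by auto
    obtain y es where y: "y \<in> carrier (binary_quotient G)" "c = \<psi> y" "set es \<subseteq> uedges G" "length es = k"
      "\<And>w. w \<in> pverts G \<Longrightarrow> coset_boundary G y w =
        (coset_boundary G x w + int (length (filter (\<lambda>e. w \<in> e) es))) mod 2"
      using Suc.IH[OF c(1)] by blast
    obtain e where e: "e \<in> uedges G" "b = c \<otimes>\<^bsub>host_group h\<^esub> \<psi> (edge_gen G e)"
      using c(2) conn by (auto simp: cayley_def)
    let ?y = "y \<otimes>\<^bsub>binary_quotient G\<^esub> edge_gen G e"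
    have "coset_boundary G ?y w =
        (coset_boundary G x w + int (length (filter (\<lambda>e. w \<in> e) (e # es)))) mod 2"
      if "w \<in> pverts G" for w
      using coset_boundary_mult[OF y(1) gen(1)[OF e(1)] that] y(5)[OF that]
        coset_boundary_edge_gen[OF e(1)] that
      by (simp add: mod_add_left_eq mod_add_right_eq algebra_simps)
    moreover have "?y \<in> carrier (binary_quotient G)" "b = \<psi> ?y"
      using y(1,2) gen(1)[OF e(1)] e(2) by simp_all
    ultimately show ?case
      using y(3,4) e(1) by (intro exI[of _ ?y] exI[of _ "e # es"]) auto
  qed
  have inj: "inj_on \<psi> (carrier (binary_quotient G))" using bij by (simp add: bij_betw_def)
  have short: "\<exists>j\<le>k. (u, v) \<in> parcs G ^^ j"
    if uv: "u \<in> pverts G" "v \<in> pverts G" and p: "(emb h u, emb h v) \<in> parcs ?C ^^ k" for u v k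
  proof -
    have "(\<psi> (l u), \<psi> (l v)) \<in> parcs ?C ^^ k" using p by (simp add: \<psi>(3))
    then obtain y es where y: "y \<in> carrier (binary_quotient G)" "\<psi> (l v) = \<psi> y"
      "set es \<subseteq> uedges G" "length es = k"
      "\<And>w. w \<in> pverts G \<Longrightarrow> coset_boundary G y w =
        (coset_boundary G (l u) w + int (length (filter (\<lambda>e. w \<in> e) es))) mod 2"
      using edges[OF _ l_closed[OF uv(1)]] by blast
    have "y = l v" using inj_onD[OF inj y(2) l_closed[OF uv(2)] y(1)] by simp
    have "odd (length (filter (\<lambda>e. w \<in> e) es)) \<longleftrightarrow> (w = u) \<noteq> (w = v)" if w: "w \<in> pverts G" for w
    proof -
      \<comment> \<open>The root contributes to the boundaries of both labels, so it cancels and the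
        parity at \<open>w\<close> depends only on \<open>u\<close> and \<open>v\<close>.\<close>
      have eq: "(of_bool (w = r) + of_bool (w = v)) mod 2 =
          ((of_bool (w = r) + of_bool (w = u)) mod 2 + int (length (filter (\<lambda>e. w \<in> e) es))) mod 2"
        using y(5)[OF w] bd_l[OF uv(2) w] bd_l[OF uv(1) w] unfolding \<open>y = l v\<close> by simp
      define n where "n = length (filter (\<lambda>e. w \<in> e) es)"
      have "even (of_bool (w = r) + of_bool (w = v) :: int) \<longleftrightarrow>
          even ((of_bool (w = r) + of_bool (w = u)) + int n)"
        using eq unfolding n_def[symmetric] by (metis even_iff_mod_2_eq_zero mod_add_left_eq)
      then show ?thesis unfolding n_def[symmetric] by auto
    qed
    then show ?thesis
      using odd_degrees_imp_path[OF y(3) uv(1)] y(4) by blast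
  qed
  show "exact_check G h"
  proof (rule isometric_imp_exact_check[OF assms(1) proper])
    fix u v assume "u \<in> pverts G" "v \<in> pverts G"
    then show "gdist ?C (emb h u) (emb h v) = gdist G u v"
      using proper_host_cayley[OF proper] short path
      by (intro gdist_eqI pair_wf_digraph) auto
  qed
qed

end

section \<open>The transition system\<close>

text \<open>Classes are nonempty and disjoint, so a chosen dart determines its class. The bound
  counts darts, two for each edge, which is ample for a termination measure.\<close>

lemma (in pair_graph) length_oriented_partition_le:
  assumes "oriented_partition G P"
  shows "length P \<le> card (parcs G)"
proof -
  define c where "c F = (SOME a. a \<in> F)" for F :: "('a \<times> 'a) set"
  have c: "c F \<in> F" if "F \<in> set P" for F
  proof -
    have "F \<noteq> {}" using assms that by (auto simp: oriented_partition_def partition_on_def)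
    then show ?thesis unfolding c_def by (rule some_in_eq[THEN iffD2])
  qed
  have "inj_on c (set P)"
  proof (rule inj_onI)
    fix F F' assume F: "F \<in> set P" "F' \<in> set P" "c F = c F'"
    then have "c F \<in> F \<inter> F'" using c by (metis IntI)
    then show "F = F'"
      using assms F(1,2) unfolding oriented_partition_def partition_on_def
      by (meson Int_iff disjnt_iff pairwiseD)
  qed
  moreover have "c ` set P \<subseteq> parcs G"
  proof (rule image_subsetI)
    fix F assume "F \<in> set P"
    then have "c F \<in> \<Union>(set P)" using c by blast
    then show "c F \<in> parcs G" using assms by (auto simp only: oriented_partition_def)
  qed
  ultimately have "card (set P) \<le> card (parcs G)"
    using card_inj_on_le pair_finite_arcs by blast
  then show ?thesis
    using assms by (simp add: oriented_partition_def distinct_card)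
qed

text \<open>Classes are finite and nonempty, so one that is not a singleton has at least two darts,
  and a largest class has no fewer. Peeling thus leaves a nonempty rest, and the number of classes
  really grows.\<close>

lemma (in pair_graph) largest_class_not_singleton:
  assumes "oriented_partition G P" "\<not> all_singletons P" "j < length P"
    and "\<forall>F\<in>set P. card F \<le> card (P ! j)"
  shows "2 \<le> card (P ! j)"
proof -
  obtain F where F: "F \<in> set P" "card F \<noteq> 1" using assms(2) by (auto simp: all_singletons_def)
  have "F \<noteq> {}" "F \<subseteq> parcs G"
    using assms(1) F(1) by (auto simp: oriented_partition_def partition_on_def)
  then have "card F \<noteq> 0" using pair_finite_arcs by (simp add: finite_subset)
  then have "2 \<le> card F" using F(2) by linarith
  then show ?thesis using assms(4) F(1) le_trans by blast
qed

lemma (in pair_graph) ex_peel: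
  assumes "oriented_partition G P" "\<not> all_singletons P"
  shows "\<exists>P'. peel P P'"
proof -
  have "set P \<noteq> {}" using assms(2) by (auto simp: all_singletons_def)
  then have "Max (card ` set P) \<in> card ` set P" by (intro Max_in) auto
  then obtain F where F: "F \<in> set P" "card F = Max (card ` set P)" by auto
  then obtain j where j: "j < length P" "P ! j = F" by (auto simp: in_set_conv_nth)
  have max: "\<forall>F'\<in>set P. card F' \<le> card (P ! j)" using F j by simp
  have "F \<noteq> {}" using assms(1) F(1) by (auto simp: oriented_partition_def partition_on_def)
  then obtain e where "e \<in> P ! j" using j by blast
  then show ?thesis unfolding peel_def using j(1) max by blast
qed

lemma (in pair_graph) peel_oriented_partition:
  assumes P: "oriented_partition G P" "\<not> all_singletons P" and "peel P P'"
  shows "oriented_partition G P'" and "length P' = Suc (length P)"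
proof -
  obtain j e where j: "j < length P" "e \<in> P ! j" "\<forall>F\<in>set P. card F \<le> card (P ! j)"
    and P': "P' = P[j := P ! j - {e}] @ [{e}]"
    using assms(3) unfolding peel_def by blast
  show "length P' = Suc (length P)" by (simp add: P')
  have dist: "distinct P" and part: "pairwise disjnt (set P)" "{} \<notin> set P"
    using P(1) by (auto simp: oriented_partition_def partition_on_def)
  define F where "F = P ! j"
  have F: "F \<in> set P" "e \<in> F" using j by (auto simp: F_def)
  have ne: "F - {e} \<noteq> {}"
  proof
    assume "F - {e} = {}"
    then have "card F \<le> card {e}" by (intro card_mono) auto
    then show False using largest_class_not_singleton[OF P j(1,3)] by (simp add: F_def)
  qed
  have disj: "F' \<inter> F = {}" if "F' \<in> set P - {F}" for F'
    using part(1) that F(1) by (auto simp: pairwise_def disjnt_def)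
  have set_upd: "set (P[j := F - {e}]) = insert (F - {e}) (set P - {F})"
    using set_update_distinct[OF dist j(1)] by (simp add: F_def)
  have set_P': "set P' = insert {e} (insert (F - {e}) (set P - {F}))"
    unfolding P' F_def[symmetric] using set_upd by simp
  \<comment> \<open>Both pieces of \<open>F\<close> are nonempty and disjoint from all other
    classes, hence new; the list stays free of repetitions.\<close>
  have "F - {e} \<notin> set P - {F}" using disj[of "F - {e}"] ne by blast
  then have "distinct (P[j := F - {e}])"
    using dist by (intro distinct_list_update) (simp_all add: F_def)
  moreover have "{e} \<notin> set (P[j := F - {e}])"
    unfolding set_upd using disj[of "{e}"] F(2) by blast
  ultimately have "distinct P'" unfolding P' F_def[symmetric] by simp
  moreover have un: "\<Union>(set P') = \<Union>(set P)"
    unfolding set_P' using F by auto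
  moreover have "partition_on (\<Union>(set P')) (set P')"
    unfolding partition_on_def
  proof (intro conjI pairwiseI refl)
    show "{} \<notin> set P'"
      using ne part(2) unfolding set_P' by auto
    have "p \<inter> q = {}" if "p \<in> set P" "q \<in> set P" "p \<noteq> q" for p q
      using that part(1) by (auto simp: pairwise_def disjnt_def)
    then show "disjnt p q" if "p \<in> set P'" "q \<in> set P'" "p \<noteq> q" for p q
      using that disj F(2) unfolding set_P' disjnt_def by blast
  qed
  ultimately show "oriented_partition G P'"
    using P(1) unfolding oriented_partition_def un by simp
qed

section \<open>Invariant and rank of the transition system\<close>

definition good_hosts :: "'v pair_pre_digraph \<Rightarrow> 'v host list \<Rightarrow> bool" where
  "good_hosts G R \<longleftrightarrow> (\<forall>h\<in>set R. proper_host G h \<and> exact_check G h)"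

text \<open>The size bound enters at \<open>Select\<close>: the binary host has just been appended
  there, and a minimal host inherits its bound. \<open>Search\<close> remembers that its queue
  consists of Hermite bases, which guarantees a finite host for each fold.\<close>

fun state_invariant :: "'v pair_pre_digraph \<Rightarrow> 'v state \<Rightarrow> bool" where
  "state_invariant G Start \<longleftrightarrow> True"
| "state_invariant G (Next Ps R) \<longleftrightarrow> (\<forall>P\<in>set Ps. oriented_partition G P) \<and> good_hosts G R"
| "state_invariant G (Refine P Ps R) \<longleftrightarrow>
     (\<forall>P\<in>set (P # Ps). oriented_partition G P) \<and> good_hosts G R"
| "state_invariant G (Search P U Hs Ps R) \<longleftrightarrow>
     (\<forall>P\<in>set (P # Ps). oriented_partition G P) \<and> good_hosts G R \<and> universal G P U \<and>
     (\<forall>H\<in>set Hs. hnf_basis (free_rank U) H)"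
| "state_invariant G (Select R) \<longleftrightarrow>
     good_hosts G R \<and> (\<exists>h\<in>set R. order (host_group h) \<le> 2 ^ (card (pverts G) - 1))"
| "state_invariant G (Return h) \<longleftrightarrow>
     proper_host G h \<and> exact_check G h \<and> order (host_group h) \<le> 2 ^ (card (pverts G) - 1)"

text \<open>The components are the phase, the initial partitions left, the room for further peeling,
  whether the universal group is still to be computed, and the queue length. Doubling the second
  makes space for a partition in progress, which must lie strictly between
  \<open>Next (P # Ps)\<close> and \<open>Next Ps\<close>.\<close>

fun state_rank :: "'v pair_pre_digraph \<Rightarrow> 'v state \<Rightarrow> nat \<times> nat \<times> nat \<times> nat \<times> nat" where
  "state_rank G Start = (3, 0, 0, 0, 0)"
| "state_rank G (Next Ps R) = (2, 2 * length Ps, 0, 0, 0)"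
| "state_rank G (Refine P Ps R) = (2, 2 * length Ps + 1, card (parcs G) - length P, 1, 0)"
| "state_rank G (Search P U Hs Ps R) =
     (2, 2 * length Ps + 1, card (parcs G) - length P, 0, length Hs)"
| "state_rank G (Select R) = (1, 0, 0, 0, 0)"
| "state_rank G (Return h) = (0, 0, 0, 0, 0)"

context pair_graph
begin

lemma step_state_invariant:
  assumes "connected (with_proj G)" "step G cap s s'" "state_invariant G s"
  shows "state_invariant G s'"
  using assms(2,3)
proof cases
  case (compute_universal P U Hs Ps R)
  then show ?thesis using assms(3) by (auto simp: fold_queue_def)
next
  case (fold_pass U H h P Hs Ps R)
  then show ?thesis
    using assms(3) fold_host_proper[of P U H h] by (auto simp: good_hosts_def)
next
  case (repair P P' U Ps R)
  then show ?thesis using assms(3) peel_oriented_partition(1) by auto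
next
  case (binary_terminal h R)
  then show ?thesis
    using assms(1,3) binary_host_proper binary_host_exact binary_host_order
    by (auto simp: good_hosts_def)
next
  case (select h R)
  then show ?thesis
    using assms(3) by (auto simp: good_hosts_def intro: order_trans)
qed (use assms(3) in \<open>auto simp: good_hosts_def\<close>)

lemma state_invariant_progress:
  assumes "connected (with_proj G)" "state_invariant G s" "\<nexists>s'. step G cap s s'"
  shows "\<exists>h. s = Return h"
proof (cases s)
  case Start
  \<comment> \<open>Any list of oriented partitions is a portfolio, the empty one included.\<close>
  then show ?thesis using assms(3) step.portfolio[of "[]" G cap] by auto
next
  case (Next Ps R)
  show ?thesis
  proof (cases Ps)
    case Nil
    then show ?thesis
      using Next assms(3) ex_binary_host[OF assms(1)] step.binary_terminal by blast
  next
    case (Cons P Ps')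
    then show ?thesis using Next assms(3) step.next_partition by blast
  qed
next
  case (Refine P Ps R)
  obtain U where U: "universal G P U" using ex_universal[OF assms(1)] by blast
  have "0 \<notin> set (torsion U)" using torsion_nonzero[OF U] Refine assms(2) by simp
  then obtain Hs where "fold_queue cap U Hs" using ex_fold_queue by blast
  then show ?thesis using Refine assms(3) step.compute_universal[OF U] by blast
next
  case (Search P U Hs Ps R)
  show ?thesis
  proof (cases Hs)
    case Nil
    show ?thesis
    proof (cases "all_singletons P")
      case True
      then show ?thesis using Search Nil assms(3) step.leave by blast
    next
      case False
      have "oriented_partition G P" using Search assms(2) by simp
      then obtain P' where "peel P P'" using ex_peel False by blast
      then show ?thesis using Search Nil False assms(3) step.repair by blast
    qed
  next
    case (Cons H Hs')
    then obtain h where h: "fold_host U H h"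
      using ex_fold_host[of P U H] Search assms(2) by auto
    then show ?thesis
      using Search Cons assms(3) step.fold_pass[OF h] step.fold_fail[OF h] by blast
  qed
next
  case (Select R)
  then obtain h0 where "h0 \<in> set R" using assms(2) by auto
  then obtain h where "h \<in> set R" "\<forall>h'. h' \<in> set R \<longrightarrow> order (host_group h) \<le> order (host_group h')"
    using ex_has_least_nat[of "\<lambda>h. h \<in> set R" h0 "\<lambda>h. order (host_group h)"] by blast
  then show ?thesis using Select assms(3) step.select by blast
qed simp

lemma step_decreases_rank:
  assumes "step G cap s s'" "state_invariant G s"
  shows "(state_rank G s', state_rank G s) \<in>
    less_than <*lex*> less_than <*lex*> less_than <*lex*> less_than <*lex*> less_than"
  using assms(1)
proof cases
  case (repair P P' U Ps R)
  then have "oriented_partition G P'" "length P' = Suc (length P)"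
    using assms(2) peel_oriented_partition by auto
  \<comment> \<open>Natural subtraction is truncated, so the strict decrease rests on the bound for
    the peeled partition \<open>P'\<close>.\<close>
  then have "card (parcs G) - length P' < card (parcs G) - length P"
    using length_oriented_partition_le by fastforce
  then show ?thesis using repair by simp
qed simp_all

end

text \<open>Both parts quantify over all runs, so they hold for every way of resolving the choices
  left open. An infinite run would be an infinite descent of \<open>state_rank\<close>; a stuck
  reachable state is a \<open>Return\<close>, whose invariant carries the certificate.\<close>

theorem theorem10:
  fixes G :: "'v pair_pre_digraph" and cap :: nat
  assumes "pair_graph G"
    and "Digraph_Component.connected (with_proj G)"
  shows "(\<nexists>\<sigma>. \<sigma> 0 = Start \<and> (\<forall>i::nat. step G cap (\<sigma> i) (\<sigma> (Suc i)))) \<and>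
    (\<forall>s. (step G cap)\<^sup>*\<^sup>* Start s \<and> (\<nexists>s'. step G cap s s') \<longrightarrow>
      (\<exists>h. s = Return h \<and>
        exact_check G h \<and>
        (\<forall>N\<in>set (moduli h). 0 < N) \<and>
        comm_group (host_group h) \<and> finite (carrier (host_group h)) \<and>
        connection_set (host_group h) (conn h) \<and>
        isometric_embedding G (host_group h) (conn h) (emb h) \<and>
        order (host_group h) \<le> 2 ^ (card (pverts G) - 1)))"
proof (intro conjI allI impI notI)
  interpret pair_graph G by fact
  let ?r = "less_than <*lex*> less_than <*lex*> less_than <*lex*> less_than <*lex*> less_than"
  assume "\<exists>\<sigma>. \<sigma> 0 = Start \<and> (\<forall>i::nat. step G cap (\<sigma> i) (\<sigma> (Suc i)))"
  then obtain \<sigma> where \<sigma>: "\<sigma> 0 = Start" "\<And>i. step G cap (\<sigma> i) (\<sigma> (Suc i))" by blast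
  have "state_invariant G (\<sigma> i)" for i
  proof (induction i)
    case (Suc i)
    then show ?case using step_state_invariant[OF assms(2) \<sigma>(2)] by blast
  qed (simp add: \<sigma>(1))
  then have "\<forall>i. (state_rank G (\<sigma> (Suc i)), state_rank G (\<sigma> i)) \<in> ?r"
    using step_decreases_rank[OF \<sigma>(2)] by blast
  moreover have "wf ?r" by (intro wf_lex_prod wf_less_than)
  ultimately show False
    unfolding wf_iff_no_infinite_down_chain by (elim notE exI[of _ "\<lambda>i. state_rank G (\<sigma> i)"])
next
  interpret pair_graph G by fact
  fix s assume s: "(step G cap)\<^sup>*\<^sup>* Start s \<and> (\<nexists>s'. step G cap s s')"
  have "(step G cap)\<^sup>*\<^sup>* Start s" using s by blast
  then have inv: "state_invariant G s"
    by (induction rule: rtranclp_induct) (auto intro: step_state_invariant[OF assms(2)])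
  then obtain h where h: "s = Return h"
    using state_invariant_progress[OF assms(2)] s by blast
  then have "proper_host G h" "exact_check G h" "order (host_group h) \<le> 2 ^ (card (pverts G) - 1)"
    using inv by simp_all
  then show "\<exists>h. s = Return h \<and>
        exact_check G h \<and>
        (\<forall>N\<in>set (moduli h). 0 < N) \<and>
        comm_group (host_group h) \<and> finite (carrier (host_group h)) \<and>
        connection_set (host_group h) (conn h) \<and>
        isometric_embedding G (host_group h) (conn h) (emb h) \<and>
        order (host_group h) \<le> 2 ^ (card (pverts G) - 1)"
    using h exact_check_imp_isometric[OF assms(2)] comm_group_cyclic_product finite_cyclic_product
    by (intro exI[of _ h]) (auto simp: proper_host_def intro: gr0I)
qed

end
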